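(* Let $n\ge2$, $k\ge1$, and let $\varsigma_{(n-1,1)}$ be a fixed $(n-1)$-cycle in $\mathfrak S_n$. For integers $r_1,\dots,r_k$ let $b_{r_1,\ldots,r_k}$ be the number of $k$-tuples $(\pi_1,\ldots,\pi_k)\in\mathfrak S_n^k$ such that $\pi_i$ has $r_i$ cycles for each $i$, $\pi_1\cdots\pi_k=\varsigma_{(n-1,1)}$, and the subgroup generated by $\pi_1,\dots,\pi_k$ acts transitively on $\{1,\dots,n\}$. Then \[ \sum_{r_1,\ldots,r_k\ge1}b_{r_1,\ldots,r_k}x_1^{r_1}\cdots x_k^{r_k}=\frac{(n!)^{k-1}}{n^k}\sum_{p_1,\ldots,p_k\ge1}M^n_{p_1,\ldots,p_k}\frac{(x_1)_{p_1}}{(p_1-1)!}\cdots\frac{(x_k)_{p_k}}{(p_k-1)!}. \]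
   Context: $(x)_p=x(x-1)\cdots(x-p+1)$ is the falling factorial. For nonnegative $n$ and integers $p_1,\dots,p_k$, $M^n_{p_1,\ldots,p_k}:=\sum_{t=0}^{\min(p_i)}(-1)^t\binom nt\prod_{i=1}^k\binom{n-t}{p_i-t}=[x_1^{p_1}\cdots x_k^{p_k}]\big((1+x_1)\cdots(1+x_k)-x_1\cdots x_k\big)^n$. *)

theory Defs
  imports
    "HOL-Algebra.Sym_Groups"
    "HOL-Algebra.Generated_Groups"
    "HOL-Combinatorics.Orbits"
    "HOL-Library.FuncSet"
begin

definition falling_factorial :: "'a::comm_ring_1 \<Rightarrow> nat \<Rightarrow> 'a" where
  "falling_factorial x p = (\<Prod>j<p. x - of_nat j)"

(* k-tuples are functions on the index set {1..k}. When t > n the truncated n - t is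
   harmless, because then n choose t = 0. *)
definition M_coeff :: "nat \<Rightarrow> nat \<Rightarrow> (nat \<Rightarrow> nat) \<Rightarrow> int" where
  "M_coeff n k p =
     (\<Sum>t = 0..Min (p ` {1..k}).
        (-1) ^ t * int (n choose t) * (\<Prod>i = 1..k. int ((n - t) choose (p i - t))))"

(* Fixed points count as cycles. *)
definition num_cycles :: "nat \<Rightarrow> (nat \<Rightarrow> nat) \<Rightarrow> nat" where
  "num_cycles n \<pi> = card (Orbits.orbit \<pi> ` {1..n})"

(* The (n-1)-cycle of S_2 is the identity, given by a list of length 1. *)
definition is_cycle_of_length :: "nat \<Rightarrow> nat \<Rightarrow> (nat \<Rightarrow> nat) \<Rightarrow> bool" where
  "is_cycle_of_length n m \<sigma> \<longleftrightarrow>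
     (\<exists>cs. distinct cs \<and> length cs = m \<and> set cs \<subseteq> {1..n} \<and> \<sigma> = cycle_of_list cs)"

definition generates_transitive :: "nat \<Rightarrow> (nat \<Rightarrow> nat) set \<Rightarrow> bool" where
  "generates_transitive n S \<longleftrightarrow>
     (\<forall>a\<in>{1..n}. \<forall>b\<in>{1..n}. \<exists>g\<in>generate (sym_group n) S. g a = b)"

(* (\<pi> 1) o ... o (\<pi> k) *)
definition tuple_product :: "nat \<Rightarrow> (nat \<Rightarrow> nat \<Rightarrow> nat) \<Rightarrow> nat \<Rightarrow> nat" where
  "tuple_product k \<pi> = foldr (\<circ>) (map \<pi> [1..<Suc k]) id"

definition transitive_factorizations ::
    "nat \<Rightarrow> nat \<Rightarrow> (nat \<Rightarrow> nat) \<Rightarrow> (nat \<Rightarrow> nat) \<Rightarrow> (nat \<Rightarrow> nat \<Rightarrow> nat) set" where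
  "transitive_factorizations n k \<sigma> r =
     {\<pi> \<in> {1..k} \<rightarrow>\<^sub>E carrier (sym_group n).
        (\<forall>i\<in>{1..k}. num_cycles n (\<pi> i) = r i) \<and>
        tuple_product k \<pi> = \<sigma> \<and>
        generates_transitive n (\<pi> ` {1..k})}"

definition b_count :: "nat \<Rightarrow> nat \<Rightarrow> (nat \<Rightarrow> nat) \<Rightarrow> (nat \<Rightarrow> nat) \<Rightarrow> nat" where
  "b_count n k \<sigma> r = card (transitive_factorizations n k \<sigma> r)"

definition pos_tuples :: "nat \<Rightarrow> (nat \<Rightarrow> nat) set" where
  "pos_tuples k = {1..k} \<rightarrow>\<^sub>E {1..}"

text \<open>
  Sums over all tuples of positive integers are written with \<^const>\<open>sum'\<close>, the sum over the
  support. The following facts show that the families concerned do have finite support, so that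
  the default value for an infinite support is never used.
\<close>

lemma M_coeff_eq_0:
  assumes "i \<in> {1..k}" "p i > n"
  shows "M_coeff n k p = 0"
  unfolding M_coeff_def
proof (intro sum.neutral ballI)
  fix t
  have "(n choose t) = 0 \<or> ((n - t) choose (p i - t)) = 0"
  proof (cases "t \<le> n")
    case True
    then have "n - t < p i - t" using assms(2) by linarith
    then show ?thesis by simp
  qed simp
  then have "(n choose t) = 0 \<or> (\<Prod>i = 1..k. int ((n - t) choose (p i - t))) = 0"
    using assms(1) by (auto intro!: prod_zero)
  then show "(-1) ^ t * int (n choose t) * (\<Prod>i = 1..k. int ((n - t) choose (p i - t))) = 0"
    by auto
qed

lemma b_count_eq_0:
  assumes "i \<in> {1..k}" "r i > n"
  shows "b_count n k \<sigma> r = 0"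
proof -
  have "num_cycles n (\<pi> i) \<le> n" for \<pi>
    unfolding num_cycles_def using card_image_le[of "{1..n}" "Orbits.orbit (\<pi> i)"] by simp
  then have "num_cycles n (\<pi> i) \<noteq> r i" for \<pi>
    using assms(2) by (metis not_le)
  then have "transitive_factorizations n k \<sigma> r = {}"
    unfolding transitive_factorizations_def using assms(1) by blast
  then show ?thesis by (simp add: b_count_def)
qed

lemma finite_support_aux:
  assumes "\<And>q i. i \<in> {1..k} \<Longrightarrow> q i > n \<Longrightarrow> f q = 0"
  shows "finite {q \<in> pos_tuples k. f q \<noteq> 0}"
proof (rule finite_subset)
  show "{q \<in> pos_tuples k. f q \<noteq> 0} \<subseteq> {1..k} \<rightarrow>\<^sub>E {1..n}"
  proof
    fix q assume "q \<in> {q \<in> pos_tuples k. f q \<noteq> 0}"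
    then have q: "q \<in> {1..k} \<rightarrow>\<^sub>E {1..}" and "f q \<noteq> 0"
      by (auto simp: pos_tuples_def)
    then have "q i \<le> n" if "i \<in> {1..k}" for i
      using assms[of i q] that by (meson not_le)
    with q show "q \<in> {1..k} \<rightarrow>\<^sub>E {1..n}"
      by (simp add: PiE_iff)
  qed
  show "finite ({1..k} \<rightarrow>\<^sub>E {1..n})"
    by (simp add: finite_PiE)
qed

lemma finite_support_b_count:
  fixes x :: "nat \<Rightarrow> 'a::field_char_0"
  shows "finite {r \<in> pos_tuples k. of_nat (b_count n k \<sigma> r) * (\<Prod>i = 1..k. x i ^ r i) \<noteq> 0}"
  by (rule finite_support_aux[where n = n]) (simp add: b_count_eq_0)

lemma finite_support_M_coeff:
  fixes x :: "nat \<Rightarrow> 'a::field_char_0"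
  shows "finite {p \<in> pos_tuples k.
    of_int (M_coeff n k p) * (\<Prod>i = 1..k. falling_factorial (x i) (p i) / fact (p i - 1)) \<noteq> 0}"
  by (rule finite_support_aux[where n = n]) (simp add: M_coeff_eq_0)

end

theory Submission
  imports Defs "HOL-Library.Poly_Mapping" "HOL-Computational_Algebra.Formal_Power_Series"
begin

text \<open>
  In the group algebra of the symmetric group on a set, the element that weights each permutation
  by \<open>x\<close> to the number of its cycles is the product of the factors \<open>x + J\<close> over the
  Jucys--Murphy elements \<open>J\<close>. Hence the number of factorizations is a coefficient of a product of
  such elements. A factorization of a cycle \<open>\<sigma>\<close> that misses only the point \<open>c\<close> fails to be
  transitive exactly if all factors fix \<open>c\<close>, so the transitive ones are counted by the difference
  of two such products, which is invariant under conjugation by the permutations of the points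
  other than \<open>c\<close>.

  The value of such an invariant element at a long cycle is an alternating binomial combination of
  the traces against the Young symmetrizers of hook shape. These symmetrizers are eigenvectors of
  the Jucys--Murphy elements of the smaller symmetric group, and the Jucys--Murphy element of the
  additional point \<open>c\<close> satisfies a cubic equation on them: its eigenvalues are the contents of
  the three cells that can be added to a hook. The weights of the three eigenvectors follow from
  the first three moments of this element. The resulting sum collapses to
  \<open>n! B(x) = \<Sum>\<^sub>t (-1)\<^sup>t (n choose t) \<Prod>\<^sub>i x\<^sub>i (x\<^sub>i - t + 1) \<dots> (x\<^sub>i - t + n - 1)\<close>,
  and Vandermonde's convolution turns each factor into falling factorials.
\<close>

section \<open>The group algebra of finitely supported permutations\<close>

text \<open>Permutations of the whole type with finite support, rather than of one fixed set, put
  the group algebras of nested sets into a single ring, so that elements for \<open>A\<close> and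
  for \<open>insert c A\<close> can be multiplied.\<close>

typedef 'b fperm = "{f :: 'b \<Rightarrow> 'b. permutation f}"
  morphisms fperm_fun Fperm
  by (rule exI[of _ id]) simp

setup_lifting type_definition_fperm

text \<open>
  The product of \<^typ>\<open>'a \<Rightarrow>\<^sub>0 'b\<close> is convolution over an additive monoid, so the composition of
  permutations is written as addition.
\<close>

instantiation fperm :: (type) monoid_add
begin

lift_definition zero_fperm :: "'a fperm" is id by simp

lift_definition plus_fperm :: "'a fperm \<Rightarrow> 'a fperm \<Rightarrow> 'a fperm" is "(\<circ>)"
  by (rule permutation_compose)

instance
  by standard (transfer, simp add: fun_eq_iff)+

end

text \<open>In a group a one-sided inverse is two-sided; this is what makes \<open>tr\<close> a
  trace.\<close>

lemma fperm_add_eq_0_commute: "f + g = 0 \<longleftrightarrow> g + f = (0 :: 'b fperm)"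
proof -
  have "f + g = 0" if "g + f = 0" for f g :: "'b fperm"
    using that
  proof transfer
    fix f g :: "'b \<Rightarrow> 'b"
    assume "permutation f" "permutation g" and gf: "g \<circ> f = id"
    then have "bij g" by (simp add: permutation_bijective)
    then show "f \<circ> g = id"
      using gf by (metis bij_is_inj inv_o_cancel comp_assoc comp_id id_comp)
  qed
  then show ?thesis by blast
qed

type_synonym ('b, 'a) galg = "'b fperm \<Rightarrow>\<^sub>0 'a"

definition scalar :: "'a::zero \<Rightarrow> ('b, 'a) galg" where
  "scalar a = Poly_Mapping.single 0 a"

definition gel :: "('b \<Rightarrow> 'b) \<Rightarrow> ('b, 'a::zero_neq_one) galg" where
  "gel f = Poly_Mapping.single (Fperm f) 1"

abbreviation gswap :: "'b \<Rightarrow> 'b \<Rightarrow> ('b, 'a::zero_neq_one) galg" where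
  "gswap a b \<equiv> gel (Transposition.transpose a b)"

text \<open>For a permutation \<open>f\<close>, the coefficient of \<open>f\<close> in
  \<open>r\<close> is \<open>tr (r * gel (inv' f))\<close>, so all counting goes through this one
  functional.\<close>

definition tr :: "('b, 'a::zero) galg \<Rightarrow> 'a" where
  "tr r = Poly_Mapping.lookup r 0"

lemma Fperm_add: "permutation f \<Longrightarrow> permutation g \<Longrightarrow> Fperm f + Fperm g = Fperm (f \<circ> g)"
  by (simp add: plus_fperm.abs_eq eq_onp_def)

lemma Fperm_eq_0_iff: "permutation f \<Longrightarrow> Fperm f = 0 \<longleftrightarrow> f = id"
  by (simp add: zero_fperm_def Fperm_inject)

lemma gel_mult:
  "permutation f \<Longrightarrow> permutation g \<Longrightarrow>
    gel f * gel g = (gel (f \<circ> g) :: ('b, 'a::semiring_1) galg)"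
  by (simp add: gel_def mult_single Fperm_add)

lemma gel_id [simp]: "gel id = 1"
  by (simp add: gel_def flip: zero_fperm_def)

lemma tr_gel: "permutation f \<Longrightarrow> tr (gel f) = (if f = id then 1 else 0)"
  by (simp add: tr_def gel_def lookup_single Fperm_eq_0_iff when_def)

lemma scalar_add: "scalar (a + b) = scalar a + scalar b"
  by (simp add: scalar_def single_add)

lemma scalar_diff: "scalar (a - b) = scalar a - scalar (b :: 'a::ab_group_add)"
  by (simp add: scalar_def single_diff)

lemma scalar_minus: "scalar (- a) = - scalar (a :: 'a::ab_group_add)"
  by (simp add: scalar_def single_uminus)

lemma scalar_mult: "scalar (a * b) = scalar a * scalar (b :: 'a::semiring_0)"
  by (simp add: scalar_def mult_single)

lemma scalar_0 [simp]: "scalar 0 = 0"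
  by (simp add: scalar_def)

lemma scalar_1 [simp]: "scalar 1 = 1"
  by (simp add: scalar_def)

lemma scalar_of_nat [simp]: "scalar (of_nat n) = of_nat n"
  by (simp add: scalar_def)

lemma scalar_of_int [simp]: "scalar (of_int n) = of_int n"
  by (simp add: scalar_def)

text \<open>Reduces linear statements about ring elements to single group elements.\<close>

lemma galg_expand:
  "r = (\<Sum>k\<in>Poly_Mapping.keys r. Poly_Mapping.single k (Poly_Mapping.lookup r k))"
proof (rule poly_mapping_eqI)
  fix k
  show "Poly_Mapping.lookup r k =
    Poly_Mapping.lookup (\<Sum>k\<in>Poly_Mapping.keys r. Poly_Mapping.single k (Poly_Mapping.lookup r k)) k"
    by (simp add: lookup_sum lookup_single when_def in_keys_iff)
qed

lemma scalar_commute: "scalar a * r = r * scalar (a :: 'a::comm_semiring_0)"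
proof -
  have "scalar a * Poly_Mapping.single k c = Poly_Mapping.single k c * scalar a" for k :: "'b fperm" and c
    by (simp add: scalar_def mult_single mult.commute)
  then show ?thesis
    by (subst (1 2) galg_expand[of r]) (simp add: sum_distrib_left sum_distrib_right)
qed

lemma scalar_left_commute: "gel f * (scalar a * s) = scalar (a :: 'a::comm_semiring_1) * (gel f * s)"
  by (metis mult.assoc scalar_commute)

lemma scalar_left_commute': "r * (scalar a * s) = scalar (a :: 'a::comm_semiring_0) * (r * s)"
  by (metis mult.assoc scalar_commute)

lemma tr_add: "tr (r + s) = tr r + tr s"
  by (simp add: tr_def lookup_add)

lemma tr_diff: "tr (r - s) = tr r - tr (s :: ('b, 'a::ab_group_add) galg)"
  by (simp add: tr_def lookup_minus)

lemma tr_sum: "tr (sum f A) = (\<Sum>a\<in>A. tr (f a))"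
  by (simp add: tr_def lookup_sum)

lemma tr_scalar: "tr (scalar a * r) = a * tr (r :: ('b, 'a::semiring_0) galg)"
proof -
  have "tr (scalar a * Poly_Mapping.single k c) = a * tr (Poly_Mapping.single k c)"
    for k :: "'b fperm" and c :: 'a
    by (simp add: scalar_def mult_single tr_def lookup_single when_def)
  then show ?thesis
    by (subst (1 2) galg_expand[of r]) (simp add: sum_distrib_left tr_sum)
qed

lemma tr_commute: "tr (r * s) = tr (s * (r :: ('b, 'a::comm_semiring_0) galg))"
proof -
  have 1: "tr (Poly_Mapping.single k c * Poly_Mapping.single l d) =
      tr (Poly_Mapping.single l d * Poly_Mapping.single k c)" for k l :: "'b fperm" and c d :: 'a
    using fperm_add_eq_0_commute[of k l]
    by (auto simp: mult_single tr_def lookup_single when_def mult.commute)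
  have 2: "tr (Poly_Mapping.single k c * s) = tr (s * Poly_Mapping.single k c)" for k c
    by (subst (1 2) galg_expand[of s]) (simp add: sum_distrib_left sum_distrib_right tr_sum 1)
  show ?thesis
    by (subst (1 2) galg_expand[of r]) (simp add: sum_distrib_left sum_distrib_right tr_sum 2)
qed

section \<open>Symmetrizers, cycle sums and Jucys--Murphy elements\<close>

definition sym_sum :: "'b set \<Rightarrow> ('b, 'a::ring_1) galg" where
  "sym_sum A = (\<Sum>f | f permutes A. gel f)"

definition alt_sum :: "'b set \<Rightarrow> ('b, 'a::ring_1) galg" where
  "alt_sum A = (\<Sum>f | f permutes A. of_int (sign f) * gel f)"

text \<open>The analogue of \<open>num_cycles\<close> over an arbitrary set, which permits induction
  by adding one point at a time.\<close>

definition cyc :: "'b set \<Rightarrow> ('b \<Rightarrow> 'b) \<Rightarrow> nat" where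
  "cyc A f = card (Orbits.orbit f ` A)"

definition cyc_sum :: "'a \<Rightarrow> 'b set \<Rightarrow> ('b, 'a::comm_ring_1) galg" where
  "cyc_sum x A = (\<Sum>f | f permutes A. scalar (x ^ cyc A f) * gel f)"

text \<open>For \<open>c \<notin> A\<close> this is the Jucys--Murphy element of the point
  \<open>c\<close> when it is adjoined after the points of \<open>A\<close>.\<close>

definition JM :: "'b set \<Rightarrow> 'b \<Rightarrow> ('b, 'a::ring_1) galg" where
  "JM A c = (\<Sum>a\<in>A. gswap a c)"

lemma permutation_transpose [simp]: "permutation (Transposition.transpose a b)"
  by (rule permutation_swap_id)

lemma gel_transpose_commute:
  assumes "f permutes A" "finite A"
  shows "gel f * gswap a b =
    (gswap (f a) (f b) * gel f :: ('b, 'a::ring_1) galg)"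
proof -
  have "f \<circ> Transposition.transpose a b = Transposition.transpose (f a) (f b) \<circ> f"
    using permutes_inj[OF assms(1)]
    by (auto simp: fun_eq_iff Transposition.transpose_def inj_eq)
  moreover have "permutation f"
    using assms permutation_permutes by blast
  ultimately show ?thesis
    by (simp add: gel_mult)
qed

text \<open>Since \<open>f\<close> fixes \<open>c\<close>, conjugation by \<open>f\<close> only
  permutes the transpositions that make up \<open>JM A c\<close>.\<close>

lemma JM_commute_gel:
  assumes "f permutes A" "finite A" "c \<notin> A"
  shows "gel f * JM A c = (JM A c * gel f :: ('b, 'a::ring_1) galg)"
proof -
  have "gel f * JM A c = (\<Sum>a\<in>A. gswap (f a) c * gel f :: ('b, 'a) galg)"
    using assms by (simp add: JM_def sum_distrib_left gel_transpose_commute permutes_not_in)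
  also have "\<dots> = (\<Sum>a\<in>A. gswap a c * gel f)"
    using permutes_imp_bij[OF assms(1)]
    by (rule sum.reindex_bij_betw[of f A A "\<lambda>a. gswap a c * gel f"])
  finally show ?thesis
    by (simp add: JM_def sum_distrib_right)
qed

text \<open>A permutation of \<open>insert c A\<close> is uniquely a permutation of
  \<open>A\<close>, possibly multiplied on the left by one transposition of \<open>c\<close> with a
  point of \<open>A\<close>. A weight that picks up \<open>y\<close> in the first case and
  \<open>z\<close> in the second makes the sum factor. The symmetrizer, the antisymmetrizer and the
  cycle sum are the cases \<open>(1, 1)\<close>, \<open>(1, -1)\<close> and \<open>(x, 1)\<close> of
  \<open>(y, z)\<close>.\<close>

lemma sum_permutes_insert:
  fixes w :: "('b \<Rightarrow> 'b) \<Rightarrow> 'a::comm_ring_1"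
  assumes "finite A" "c \<notin> A"
    and w1: "\<And>f. f permutes A \<Longrightarrow> w f = y * v f"
    and w2: "\<And>f a. f permutes A \<Longrightarrow> a \<in> A \<Longrightarrow> w (Transposition.transpose a c \<circ> f) = z * v f"
  shows "(\<Sum>f | f permutes insert c A. scalar (w f) * gel f) =
    (scalar y + scalar z * JM A c) * (\<Sum>f | f permutes A. scalar (v f) * gel f)"
proof -
  let ?P = "{f. f permutes A}"
  have fin: "finite ?P"
    using assms(1) by (rule finite_permutations)
  have perm: "permutation f" if "f permutes A" for f
    using that assms(1) permutation_permutes by blast
  have "(\<Sum>f | f permutes insert c A. scalar (w f) * gel f) =
      (\<Sum>b\<in>insert c A. \<Sum>f\<in>?P. scalar (w (Transposition.transpose c b \<circ> f)) *
        gel (Transposition.transpose c b \<circ> f))"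
    by (rule sum_over_permutations_insert[OF assms(1,2)])
  also have "\<dots> = (\<Sum>f\<in>?P. scalar (w f) * gel f) +
      (\<Sum>b\<in>A. \<Sum>f\<in>?P. scalar (w (Transposition.transpose c b \<circ> f)) *
        gel (Transposition.transpose c b \<circ> f))"
    using assms(1,2) by (simp add: transpose_def)
  also have "(\<Sum>f\<in>?P. scalar (w f) * gel f) = scalar y * (\<Sum>f\<in>?P. scalar (v f) * gel f)"
    by (simp add: w1 sum_distrib_left scalar_mult mult.assoc)
  also have "(\<Sum>b\<in>A. \<Sum>f\<in>?P. scalar (w (Transposition.transpose c b \<circ> f)) *
        gel (Transposition.transpose c b \<circ> f)) =
      (\<Sum>b\<in>A. \<Sum>f\<in>?P. scalar z * gswap b c * (scalar (v f) * gel f))"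
    using w2 perm
    by (intro sum.cong refl)
      (simp add: transpose_commute[of c] scalar_mult gel_mult scalar_left_commute mult.assoc)
  also have "\<dots> = scalar z * JM A c * (\<Sum>f\<in>?P. scalar (v f) * gel f)"
    by (simp add: JM_def sum_distrib_left sum_distrib_right sum.swap[of _ A])
  finally show ?thesis
    by (simp add: algebra_simps)
qed

lemma sum_permutes_JM_commute:
  fixes v :: "('b \<Rightarrow> 'b) \<Rightarrow> 'a::comm_ring_1"
  assumes "finite A" "c \<notin> A" "D \<subseteq> A"
  shows "JM A c * (\<Sum>f | f permutes D. scalar (v f) * gel f) =
    (\<Sum>f | f permutes D. scalar (v f) * gel f) * JM A c"
  using assms permutes_subset[of _ D A]
  by (simp add: sum_distrib_left sum_distrib_right scalar_left_commute' [of "JM A c"] mult.assoc JM_commute_gel)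

lemma alt_sum_altdef:
  "alt_sum A = (\<Sum>f | f permutes A. scalar (of_int (sign f)) * gel f)"
  by (simp add: alt_sum_def)

lemma sym_sum_altdef: "sym_sum A = (\<Sum>f | f permutes A. scalar 1 * gel f)"
  by (simp add: sym_sum_def)

text \<open>Multiplication by the transposition on the left splices \<open>c\<close> into the cycle
  of \<open>a\<close>, immediately before \<open>a\<close>, and leaves all other cycles
  alone.\<close>

lemma orbit_transpose_comp:
  assumes p: "p permutes A" and "finite A" "c \<notin> A" "a \<in> A" "y \<in> A"
  shows "Orbits.orbit p y = Orbits.orbit (Transposition.transpose a c \<circ> p) y - {c}"
proof -
  let ?s = "Transposition.transpose a c \<circ> p"
  have pA: "p z \<in> A \<longleftrightarrow> z \<in> A" for z
    using p by (rule permutes_in_image)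
  have pc: "p c = c"
    using p \<open>c \<notin> A\<close> by (rule permutes_not_in)
  have sc: "?s c = a"
    by (simp add: pc)
  have s: "?s z = (if p z = a then c else p z)" if "z \<in> A" for z
    using that pA[of z] \<open>c \<notin> A\<close> by (auto simp: transpose_def)
  have "z \<in> A \<and> z \<in> Orbits.orbit ?s y" if "z \<in> Orbits.orbit p y" for z
    using that
  proof induction
    case base
    show ?case
    proof (cases "p y = a")
      case True
      then have "?s (?s y) = a" using s[OF \<open>y \<in> A\<close>] sc by simp
      then show ?thesis
        using True \<open>a \<in> A\<close> by (metis orbit.base orbit.step)
    next
      case False
      then show ?thesis
        using s[OF \<open>y \<in> A\<close>] pA \<open>y \<in> A\<close> by (metis orbit.base)
    qed
  next
    case (step z)
    then have "z \<in> A" by simp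
    show ?case
    proof (cases "p z = a")
      case True
      then have "?s (?s z) = a" using s[OF \<open>z \<in> A\<close>] sc by simp
      then show ?thesis
        using True \<open>a \<in> A\<close> step by (metis orbit.step)
    next
      case False
      then show ?thesis
        using s[OF \<open>z \<in> A\<close>] pA \<open>z \<in> A\<close> step by (metis orbit.step)
    qed
  qed
  \<comment> \<open>The induction runs through \<open>c\<close>, which lies outside the orbits of
    \<open>p\<close>; there the invariant speaks of \<open>a\<close>, the next point after
    \<open>c\<close>.\<close>
  moreover have "(z \<noteq> c \<longrightarrow> z \<in> A \<and> z \<in> Orbits.orbit p y) \<and> (z = c \<longrightarrow> a \<in> Orbits.orbit p y)"
    if "z \<in> Orbits.orbit ?s y" for z
    using that
  proof induction
    case base
    show ?case
      using s[OF \<open>y \<in> A\<close>] pA \<open>y \<in> A\<close> \<open>c \<notin> A\<close> orbit.base[of p y] by (metis)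
  next
    case (step z)
    show ?case
    proof (cases "z = c")
      case True
      then show ?thesis using sc step \<open>a \<in> A\<close> \<open>c \<notin> A\<close> by metis
    next
      case False
      then show ?thesis
        using s[of z] pA[of z] \<open>c \<notin> A\<close> step orbit.step[of z p y] by metis
    qed
  qed
  ultimately show ?thesis
    using \<open>c \<notin> A\<close> by blast
qed

lemma cyc_insert_transpose:
  assumes p: "p permutes A" and "finite A" "c \<notin> A" "a \<in> A"
  shows "cyc (insert c A) (Transposition.transpose a c \<circ> p) = cyc A p"
proof -
  let ?s = "Transposition.transpose a c \<circ> p"
  have "permutation p"
    using assms permutation_permutes by blast
  then have perm: "permutation ?s"
    by (intro permutation_compose) auto
  have self: "z \<in> Orbits.orbit ?s z" for z
    using perm by (rule permutation_self_in_orbit)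
  have "?s c = a"
    using assms by (simp add: permutes_not_in)
  then have "Orbits.orbit ?s c = Orbits.orbit ?s a"
    using permutation_orbit_step[OF perm, of c] by simp
  then have 1: "Orbits.orbit ?s ` insert c A = Orbits.orbit ?s ` A"
    using \<open>a \<in> A\<close> by auto
  have 2: "Orbits.orbit p ` A = (\<lambda>B. B - {c}) ` Orbits.orbit ?s ` A"
    using orbit_transpose_comp[OF assms] by (auto simp: image_image)
  \<comment> \<open>Two such orbits that agree outside \<open>c\<close> share a point of
    \<open>A\<close>, and orbits that share a point coincide.\<close>
  have "inj_on (\<lambda>B. B - {c}) (Orbits.orbit ?s ` A)"
  proof (rule inj_onI, clarify)
    fix y z
    assume "y \<in> A" "z \<in> A" "Orbits.orbit ?s y - {c} = Orbits.orbit ?s z - {c}"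
    then have "y \<in> Orbits.orbit ?s z"
      using self[of y] \<open>c \<notin> A\<close> by blast
    then show "Orbits.orbit ?s y = Orbits.orbit ?s z"
      using cyclic_on_orbit'[OF perm, of z] orbit_cyclic_eq3 by fastforce
  qed
  then show ?thesis
    unfolding cyc_def 1 2 by (simp add: card_image)
qed

lemma cyc_insert_fixed:
  assumes p: "p permutes A" and "finite A" "c \<notin> A"
  shows "cyc (insert c A) p = Suc (cyc A p)"
proof -
  have "Orbits.orbit p c = {c}"
    using assms by (simp add: orbit_eq_singleton_iff permutes_not_in)
  moreover have "{c} \<notin> Orbits.orbit p ` A"
    using permutes_orbit_subset[OF p] \<open>c \<notin> A\<close> by (metis image_iff insert_subset)
  ultimately show ?thesis
    using \<open>finite A\<close> by (simp add: cyc_def)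
qed

section \<open>Splitting off the Jucys--Murphy element of a new point\<close>

lemma JM_commute_sym_sum:
  "finite A \<Longrightarrow> c \<notin> A \<Longrightarrow> D \<subseteq> A \<Longrightarrow>
    JM A c * sym_sum D = sym_sum D * (JM A c :: ('b, 'a::comm_ring_1) galg)"
  unfolding sym_sum_altdef by (rule sum_permutes_JM_commute)

lemma JM_commute_alt_sum:
  "finite A \<Longrightarrow> c \<notin> A \<Longrightarrow> D \<subseteq> A \<Longrightarrow>
    JM A c * alt_sum D = alt_sum D * (JM A c :: ('b, 'a::comm_ring_1) galg)"
  unfolding alt_sum_altdef by (rule sum_permutes_JM_commute)

lemma JM_commute_cyc_sum:
  "finite A \<Longrightarrow> c \<notin> A \<Longrightarrow> D \<subseteq> A \<Longrightarrow> JM A c * cyc_sum x D = cyc_sum x D * JM A c"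
  unfolding cyc_sum_def by (rule sum_permutes_JM_commute)

context
  fixes A :: "'b set" and c :: 'b
  assumes fin: "finite A" and c: "c \<notin> A"
begin

lemma sym_sum_insert_left:
  "sym_sum (insert c A) = (1 + JM A c) * (sym_sum A :: ('b, 'a::comm_ring_1) galg)"
  using sum_permutes_insert[OF fin c, of "\<lambda>_. 1" 1 "\<lambda>_. 1" 1]
  by (simp add: sym_sum_altdef)

lemma alt_sum_insert_left:
  "alt_sum (insert c A) = (1 - JM A c) * (alt_sum A :: ('b, 'a::comm_ring_1) galg)"
proof -
  have "permutation f" if "f permutes A" for f
    using that fin permutation_permutes by blast
  then have "sign (Transposition.transpose a c \<circ> f) = - sign f" if "f permutes A" "a \<in> A" for f a
    using that c by (auto simp: sign_compose sign_swap_id)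
  then show ?thesis
    using sum_permutes_insert[OF fin c, of "\<lambda>f. of_int (sign f)" 1 "\<lambda>f. of_int (sign f)" "-1"]
    by (simp add: alt_sum_altdef scalar_minus del: scalar_of_int)
qed

text \<open>One step of Jucys' factorization: the new point either forms a cycle of its own, which
  contributes \<open>x\<close>, or is spliced into an existing cycle, which leaves the number of
  cycles unchanged.\<close>

lemma cyc_sum_insert_left: "cyc_sum x (insert c A) = (scalar x + JM A c) * cyc_sum x A"
  using sum_permutes_insert[OF fin c, of "\<lambda>f. x ^ cyc (insert c A) f" x "\<lambda>f. x ^ cyc A f" 1]
  by (simp add: cyc_sum_def cyc_insert_fixed cyc_insert_transpose fin c)

lemma sym_sum_insert_right:
  "sym_sum (insert c A) = sym_sum A * (1 + JM A c :: ('b, 'a::comm_ring_1) galg)"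
  by (simp add: sym_sum_insert_left JM_commute_sym_sum fin c algebra_simps)

lemma alt_sum_insert_right:
  "alt_sum (insert c A) = alt_sum A * (1 - JM A c :: ('b, 'a::comm_ring_1) galg)"
  by (simp add: alt_sum_insert_left JM_commute_alt_sum fin c algebra_simps)

lemma cyc_sum_insert_right: "cyc_sum x (insert c A) = cyc_sum x A * (scalar x + JM A c)"
  by (simp add: cyc_sum_insert_left JM_commute_cyc_sum fin c algebra_simps scalar_commute)

end

section \<open>Young symmetrizers of hooks\<close>

lemma of_nat_left_commute: "r * (of_nat k * s) = of_nat k * (r * s :: 'c::semiring_1)"
  by (metis mult.assoc mult_of_nat_commute)

lemma permutes_conj:
  assumes "f permutes A" "bij g"
  shows "g \<circ> f \<circ> inv' g permutes g ` A"
proof -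
  have "bij (g \<circ> f \<circ> inv' g)"
    using assms by (intro bij_comp bij_imp_bij_inv permutes_bij)
  moreover have "(g \<circ> f \<circ> inv' g) y = y" if "y \<notin> g ` A" for y
  proof -
    have "inv' g y \<notin> A"
      using that \<open>bij g\<close> by (metis bij_inv_eq_iff image_eqI)
    then show ?thesis
      using assms by (simp add: permutes_not_in surj_f_inv_f bij_is_surj)
  qed
  ultimately show ?thesis
    unfolding permutes_def bij_iff by blast
qed

text \<open>Conjugation by \<open>g\<close> carries the permutations of \<open>A\<close> bijectively
  to those of its image under \<open>g\<close>; the weights only have to be compatible with it. Sign
  and number of cycles are.\<close>

lemma gel_conj_sum:
  fixes v v' :: "('b \<Rightarrow> 'b) \<Rightarrow> 'a::comm_ring_1"
  assumes "finite A" "permutation g"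
    and v: "\<And>f. f permutes A \<Longrightarrow> v' (g \<circ> f \<circ> inv' g) = v f"
  shows "gel g * (\<Sum>f | f permutes A. scalar (v f) * gel f) =
    (\<Sum>f | f permutes (g ` A). scalar (v' f) * gel f) * gel g"
proof -
  have g: "bij g"
    using assms(2) by (rule permutation_bijective)
  have gA: "inv' g ` g ` A = A"
    using g by (simp add: bij_is_inj image_inv_f_f)
  have perm: "permutation f" if "f permutes A" for f
    using that assms(1) permutation_permutes by blast
  have perm': "permutation f" if "f permutes g ` A" for f
    using that assms(1) permutation_permutes by blast
  have inv1: "inv' g \<circ> g = id" "g \<circ> inv' g = id"
    using g bij_is_surj[OF g] by (simp_all add: bij_is_inj surj_iff)
  have inv2: "inv' (inv' g) = g"
    using g by (rule inv_inv_eq)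
  have "(\<Sum>f | f permutes A. scalar (v f) * (gel g * gel f)) =
      (\<Sum>f | f permutes (g ` A). scalar (v' f) * (gel f * gel g))"
  proof (rule sum.reindex_bij_witness[where j = "\<lambda>f. g \<circ> f \<circ> inv' g" and i = "\<lambda>f. inv' g \<circ> f \<circ> g"])
    fix f assume "f \<in> {f. f permutes A}"
    then have f: "f permutes A" by simp
    show "inv' g \<circ> (g \<circ> f \<circ> inv' g) \<circ> g = f"
      using inv1 by (metis comp_assoc comp_id id_comp)
    show 1: "g \<circ> f \<circ> inv' g \<in> {f. f permutes g ` A}"
      using permutes_conj[OF f g] by simp
    have "g \<circ> f = (g \<circ> f \<circ> inv' g) \<circ> g"
      using inv1 by (metis comp_assoc comp_id)
    then show "scalar (v' (g \<circ> f \<circ> inv' g)) * (gel (g \<circ> f \<circ> inv' g) * gel g) =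
        scalar (v f) * (gel g * gel f)"
      using v[OF f] perm[OF f] perm'[of "g \<circ> f \<circ> inv' g"] 1 assms(2) by (simp add: gel_mult)
  next
    fix f assume "f \<in> {f. f permutes g ` A}"
    then have f: "f permutes g ` A" by simp
    show "g \<circ> (inv' g \<circ> f \<circ> g) \<circ> inv' g = f"
      using inv1 by (metis comp_assoc comp_id id_comp)
    show "inv' g \<circ> f \<circ> g \<in> {f. f permutes A}"
      using permutes_conj[OF f bij_imp_bij_inv[OF g]] by (simp add: inv2 gA)
  qed
  then show ?thesis
    by (simp add: sum_distrib_left sum_distrib_right scalar_left_commute mult.assoc)
qed

lemma sign_conj:
  assumes "permutation f" "permutation g"
  shows "sign (g \<circ> f \<circ> inv' g) = sign f"
  using assms by (simp add: sign_compose sign_inverse permutation_compose permutation_inverse)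

lemma cyc_conj:
  assumes "permutation f" "bij g"
  shows "cyc (g ` A) (g \<circ> f \<circ> inv' g) = cyc A f"
proof -
  have "Orbits.orbit (g \<circ> f \<circ> inv' g) (g y) = g ` Orbits.orbit f y" for y
    by (rule orbit_inverse[symmetric])
      (use assms in \<open>auto simp: permutation_self_in_orbit bij_is_inj inv_f_f\<close>)
  then have "Orbits.orbit (g \<circ> f \<circ> inv' g) ` g ` A = (`) g ` Orbits.orbit f ` A"
    by (simp add: image_image)
  moreover have "inj_on ((`) g) (Orbits.orbit f ` A)"
    using bij_is_inj[OF assms(2)] by (meson inj_on_image inj_on_subset subset_UNIV)
  ultimately show ?thesis
    by (simp add: cyc_def card_image)
qed

lemma gel_conj_sym_sum:
  assumes "finite A" "permutation g"
  shows "gel g * sym_sum A = (sym_sum (g ` A) * gel g :: ('b, 'a::comm_ring_1) galg)"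
  unfolding sym_sum_altdef using assms by (rule gel_conj_sum) simp

lemma gel_conj_alt_sum:
  assumes "finite A" "permutation g"
  shows "gel g * alt_sum A = (alt_sum (g ` A) * gel g :: ('b, 'a::comm_ring_1) galg)"
  unfolding alt_sum_altdef using assms
proof (rule gel_conj_sum)
  fix f assume "f permutes A"
  then have "permutation f"
    using assms(1) permutation_permutes by blast
  then show "of_int (sign (g \<circ> f \<circ> inv' g)) = (of_int (sign f) :: 'a)"
    using assms(2) by (simp add: sign_conj)
qed

lemma gel_commute_cyc_sum:
  assumes "finite A" "g permutes A"
  shows "gel g * cyc_sum x A = cyc_sum x A * gel g"
proof -
  have g: "permutation g"
    using assms permutation_permutes by blast
  have "gel g * cyc_sum x A = cyc_sum x (g ` A) * gel g"
    unfolding cyc_sum_def using assms(1) g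
  proof (rule gel_conj_sum)
    fix f assume "f permutes A"
    then have "permutation f"
      using assms(1) permutation_permutes by blast
    then show "x ^ cyc (g ` A) (g \<circ> f \<circ> inv' g) = x ^ cyc A f"
      using permutation_bijective[OF g] by (simp add: cyc_conj)
  qed
  then show ?thesis
    using assms(2) by (simp add: permutes_image)
qed

lemma gel_mult_sym_sum:
  assumes "finite A" "g permutes A"
  shows "gel g * sym_sum A = (sym_sum A :: ('b, 'a::comm_ring_1) galg)"
    and "sym_sum A * gel g = (sym_sum A :: ('b, 'a::comm_ring_1) galg)"
proof -
  have perm: "permutation f" if "f permutes A" for f
    using that assms(1) permutation_permutes by blast
  have "gel g * sym_sum A = (\<Sum>f | f permutes A. gel (g \<circ> f) :: ('b, 'a) galg)"
    using assms perm by (simp add: sym_sum_def sum_distrib_left gel_mult)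
  also have "\<dots> = sym_sum A"
    unfolding sym_sum_def by (rule setum_permutations_compose_left[OF assms(2), symmetric])
  finally show "gel g * sym_sum A = (sym_sum A :: ('b, 'a) galg)" .
  then show "sym_sum A * gel g = (sym_sum A :: ('b, 'a) galg)"
    using gel_conj_sym_sum[OF assms(1) perm[OF assms(2)], where 'a = 'a] assms(2)
    by (simp add: permutes_image)
qed

lemma gel_mult_alt_sum:
  assumes "finite A" "g permutes A"
  shows "gel g * alt_sum A = (of_int (sign g) * alt_sum A :: ('b, 'a::comm_ring_1) galg)"
    and "alt_sum A * gel g = (of_int (sign g) * alt_sum A :: ('b, 'a::comm_ring_1) galg)"
proof -
  have perm: "permutation f" if "f permutes A" for f
    using that assms(1) permutation_permutes by blast
  have "gel g * alt_sum A =
      (\<Sum>f | f permutes A. of_int (sign g) * (of_int (sign (g \<circ> f)) * gel (g \<circ> f)) :: ('b, 'a) galg)"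
    unfolding alt_sum_def sum_distrib_left
  proof (rule sum.cong)
    fix f assume "f \<in> {f. f permutes A}"
    then have f: "f permutes A" by simp
    have "gel g * (of_int (sign f) * gel f) = of_int (sign f) * (gel g * gel f :: ('b, 'a) galg)"
      by (metis mult.assoc mult_of_int_commute)
    moreover have "sign g * sign (g \<circ> f) = sign f"
      using perm[OF f] perm[OF assms(2)] by (simp add: sign_compose)
    ultimately show "gel g * (of_int (sign f) * gel f) =
        of_int (sign g) * (of_int (sign (g \<circ> f)) * gel (g \<circ> f) :: ('b, 'a) galg)"
      using perm[OF f] perm[OF assms(2)] by (metis gel_mult mult.assoc of_int_mult)
  qed simp
  also have "\<dots> = of_int (sign g) * alt_sum A"
    unfolding alt_sum_def sum_distrib_left
    by (rule setum_permutations_compose_left[OF assms(2), symmetric])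
  finally show "gel g * alt_sum A = (of_int (sign g) * alt_sum A :: ('b, 'a) galg)" .
  then show "alt_sum A * gel g = (of_int (sign g) * alt_sum A :: ('b, 'a) galg)"
    using gel_conj_alt_sum[OF assms(1) perm[OF assms(2)], where 'a = 'a] assms(2)
    by (simp add: permutes_image)
qed

lemma transpose_mult_sym_sum:
  assumes "finite A" "a \<in> A" "b \<in> A"
  shows "gswap a b * sym_sum A = (sym_sum A :: ('b, 'a::comm_ring_1) galg)"
    and "sym_sum A * gswap a b = (sym_sum A :: ('b, 'a::comm_ring_1) galg)"
  using assms by (auto intro!: gel_mult_sym_sum permutes_swap_id)

lemma transpose_mult_alt_sum:
  assumes "finite A" "a \<in> A" "b \<in> A" "a \<noteq> b"
  shows "gswap a b * alt_sum A = (- alt_sum A :: ('b, 'a::comm_ring_1) galg)"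
    and "alt_sum A * gswap a b = (- alt_sum A :: ('b, 'a::comm_ring_1) galg)"
  using assms gel_mult_alt_sum[OF assms(1) permutes_swap_id[OF assms(2,3)]]
  by (simp_all add: sign_swap_id)

lemma JM_mult_sym_sum:
  assumes "finite A" "B \<subseteq> A" "c \<in> A"
  shows "JM B c * sym_sum A = (of_nat (card B) * sym_sum A :: ('b, 'a::comm_ring_1) galg)"
proof -
  have "JM B c * sym_sum A = (\<Sum>a\<in>B. sym_sum A :: ('b, 'a) galg)"
    unfolding JM_def sum_distrib_right using assms
    by (intro sum.cong refl transpose_mult_sym_sum) auto
  then show ?thesis by simp
qed

lemma JM_mult_alt_sum:
  assumes "finite A" "B \<subseteq> A" "c \<in> A" "c \<notin> B"
  shows "JM B c * alt_sum A = (- of_nat (card B) * alt_sum A :: ('b, 'a::comm_ring_1) galg)"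
proof -
  have "JM B c * alt_sum A = (\<Sum>a\<in>B. - alt_sum A :: ('b, 'a) galg)"
    unfolding JM_def sum_distrib_right using assms
    by (intro sum.cong refl transpose_mult_alt_sum) auto
  then show ?thesis by simp
qed

lemma permutes_singleton: "f permutes {m} \<longleftrightarrow> f = id"
  by (simp add: permutes_sing)

lemma sym_sum_singleton [simp]: "sym_sum {m} = 1"
  by (simp add: sym_sum_def permutes_singleton)

lemma alt_sum_singleton [simp]: "alt_sum {m} = 1"
  by (simp add: alt_sum_def permutes_singleton)

lemma alt_sum_empty [simp]: "alt_sum {} = 1"
  by (simp add: alt_sum_def)

lemma cyc_sum_empty [simp]: "cyc_sum x {} = 1"
  by (simp add: cyc_sum_def cyc_def)

lemma JM_insert: "finite A \<Longrightarrow> a \<notin> A \<Longrightarrow> JM (insert a A) c = gswap a c + JM A c"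
  by (simp add: JM_def)

lemma JM_union: "finite A \<Longrightarrow> finite B \<Longrightarrow> A \<inter> B = {} \<Longrightarrow> JM (A \<union> B) c = JM A c + JM B c"
  by (simp add: JM_def sum.union_disjoint)

section \<open>Antisymmetrizers against symmetrizers\<close>

lemma galg_eq_minus_self:
  assumes "r = - (r :: ('b, 'a::field_char_0) galg)"
  shows "r = 0"
proof (rule poly_mapping_eqI)
  fix k
  have "Poly_Mapping.lookup r k = - Poly_Mapping.lookup r k"
    using assms by (metis lookup_uminus)
  then show "Poly_Mapping.lookup r k = Poly_Mapping.lookup 0 k"
    by simp
qed

text \<open>The classical sign argument: the symmetrizer emits the transposition of \<open>m\<close>
  and \<open>c\<close>, which passes the middle factor as the transposition of \<open>a\<close> and
  \<open>m\<close>, and the antisymmetrizer absorbs that with a sign. So the product equals its own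
  negative.\<close>

lemma alt_transpose_sym_eq_0:
  assumes "finite D" "finite E" "a \<in> D" "m \<in> D" "a \<noteq> m" "m \<in> E" "c \<in> E" "c \<notin> D"
  shows "alt_sum D * (gswap a c * sym_sum E) = (0 :: ('b, 'a::field_char_0) galg)"
    (is "?t = 0")
proof -
  have "Transposition.transpose a c \<circ> Transposition.transpose m c =
      Transposition.transpose a m \<circ> Transposition.transpose a c"
    using assms by (auto simp: fun_eq_iff transpose_def)
  then have *: "gswap a c * gswap m c =
      (gswap a m * gswap a c :: ('b, 'a) galg)"
    by (simp add: gel_mult)
  have "?t = alt_sum D * (gswap a c * (gswap m c * sym_sum E))"
    using assms by (simp add: transpose_mult_sym_sum)
  also have "\<dots> = (alt_sum D * gswap a m) * (gswap a c * sym_sum E)"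
    by (metis * mult.assoc)
  also have "\<dots> = - ?t"
    using assms by (simp add: transpose_mult_alt_sum)
  finally show ?thesis
    by (rule galg_eq_minus_self)
qed

lemma alt_sum_commute_disjoint:
  assumes "finite D" "finite E" "D \<inter> E = {}" "g permutes E"
  shows "gel g * alt_sum D = (alt_sum D * gel g :: ('b, 'a::comm_ring_1) galg)"
proof -
  have "g x = x" if "x \<in> D" for x
    using that assms by (meson disjoint_iff permutes_not_in)
  then have "g ` D = D" by simp
  moreover have "permutation g"
    using assms permutation_permutes by blast
  ultimately show ?thesis
    using gel_conj_alt_sum[OF assms(1), of g] by simp
qed

lemma alt_sum_commute_sym_sum:
  assumes "finite D" "finite E" "D \<inter> E = {}"
  shows "sym_sum E * alt_sum D = (alt_sum D * sym_sum E :: ('b, 'a::comm_ring_1) galg)"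
  unfolding sym_sum_def sum_distrib_left sum_distrib_right
  using assms by (intro sum.cong refl alt_sum_commute_disjoint) auto

lemma JM_commute_alt_sum_disjoint:
  assumes "finite D" "finite E" "D \<inter> E = {}" "c \<notin> D"
  shows "JM E c * alt_sum D = (alt_sum D * JM E c :: ('b, 'a::comm_ring_1) galg)"
  unfolding JM_def sum_distrib_left sum_distrib_right
  using assms
  by (intro sum.cong refl alt_sum_commute_disjoint[of D "insert c E"] permutes_swap_id) auto

text \<open>The unnormalized Young symmetrizer of the hook with corner \<open>m\<close>, leg
  \<open>F\<close> and arm \<open>B\<close>: the antisymmetrizer of the column times the symmetrizer
  of the row.\<close>

definition hook :: "'b set \<Rightarrow> 'b \<Rightarrow> 'b set \<Rightarrow> ('b, 'a::ring_1) galg" where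
  "hook F m B = alt_sum (insert m F) * sym_sum (insert m B)"

definition hook_partition :: "'b set \<Rightarrow> 'b set \<Rightarrow> 'b \<Rightarrow> 'b set \<Rightarrow> bool" where
  "hook_partition A F m B \<longleftrightarrow>
    finite F \<and> finite B \<and> F \<inter> B = {} \<and> m \<notin> F \<and> m \<notin> B \<and> A = insert m (F \<union> B)"

lemma hook_insert_right:
  assumes A: "hook_partition A F m B" and c: "c \<notin> A"
  shows "hook F m (insert c B) = (hook F m B * (1 + JM (insert m B) c) :: ('b, 'a::comm_ring_1) galg)"
proof -
  have "sym_sum (insert c (insert m B)) = sym_sum (insert m B) * (1 + JM (insert m B) c :: ('b, 'a) galg)"
    using assms by (intro sym_sum_insert_right) (auto simp: hook_partition_def)
  then show ?thesis
    by (simp add: hook_def insert_commute mult.assoc)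
qed

text \<open>The eigenvalue is the content of the cell \<open>c\<close> at the end of the arm. The
  transpositions with \<open>m\<close> and with \<open>B\<close> are absorbed by the row
  symmetrizer, and those with the leg \<open>F\<close> vanish by the sign argument.\<close>

lemma JM_mult_hook_insert:
  assumes A: "hook_partition A F m B" and c: "c \<notin> A"
  shows "JM A c * hook F m (insert c B) =
    (of_nat (Suc (card B)) * hook F m (insert c B) :: ('b, 'a::field_char_0) galg)"
proof -
  let ?e = "alt_sum (insert m F) :: ('b, 'a) galg" and ?s = "sym_sum (insert m (insert c B)) :: ('b, 'a) galg"
  have fin: "finite F" "finite B" and disj: "F \<inter> B = {}" "m \<notin> F" "m \<notin> B" and
    A_eq: "A = insert m F \<union> B" and c': "c \<noteq> m" "c \<notin> F" "c \<notin> B"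
    using A c by (auto simp: hook_partition_def)
  have J: "JM A c = JM (insert m F) c + JM B c"
    unfolding A_eq using fin disj by (intro JM_union) auto
  have "JM F c * ?s = (\<Sum>a\<in>F. gswap a c * ?s)"
    by (simp add: JM_def sum_distrib_right)
  then have "?e * (JM F c * ?s) = (\<Sum>a\<in>F. ?e * (gswap a c * ?s))"
    by (simp add: sum_distrib_left)
  also have "\<dots> = 0"
    using fin disj c' by (intro sum.neutral ballI alt_transpose_sym_eq_0[where m = m]) auto
  finally have 0: "?e * (JM F c * ?s) = 0" .
  have 1: "gswap m c * ?s = ?s"
    using fin by (intro transpose_mult_sym_sum) auto
  have 2: "JM (insert m F) c * ?e = ?e * JM (insert m F) c"
    using fin c' by (intro JM_commute_alt_sum) auto
  have 3: "JM B c * ?e = ?e * JM B c"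
    using fin disj c' by (intro JM_commute_alt_sum_disjoint) auto
  have 4: "JM B c * ?s = of_nat (card B) * ?s"
    using fin by (intro JM_mult_sym_sum) auto
  have "JM A c * (?e * ?s) = ?e * (JM (insert m F) c * ?s) + ?e * (JM B c * ?s)"
    by (simp add: J distrib_right 2 3 flip: mult.assoc)
  also have "JM (insert m F) c * ?s = ?s + JM F c * ?s"
    using fin disj by (simp add: JM_insert distrib_right 1)
  also have "?e * (?s + JM F c * ?s) + ?e * (JM B c * ?s) = ?e * ?s + ?e * (of_nat (card B) * ?s)"
    by (simp add: distrib_left 0 4)
  also have "\<dots> = of_nat (Suc (card B)) * (?e * ?s)"
    by (simp add: distrib_right mult_of_nat_commute mult.assoc)
  finally show ?thesis
    by (simp add: hook_def)
qed

text \<open>The case of a single column. Each new point contributes the factor \<open>x\<close> plus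
  the content of its cell, because its Jucys--Murphy element acts on the larger antisymmetrizer by
  minus the number of earlier points.\<close>

lemma cyc_sum_mult_alt_sum:
  assumes "finite D"
  shows "cyc_sum x D * alt_sum D =
    (scalar (\<Prod>i<card D. x - of_nat i) * alt_sum D :: ('b, 'a::field_char_0) galg)"
  using assms
proof (induction D rule: finite_induct)
  case (insert c D)
  let ?J = "JM D c :: ('b, 'a) galg"
  have "?J * alt_sum (insert c D) = - of_nat (card D) * alt_sum (insert c D)"
    using insert.hyps by (intro JM_mult_alt_sum) auto
  then have "(scalar x + ?J) * alt_sum (insert c D) = scalar (x - of_nat (card D)) * alt_sum (insert c D)"
    by (simp add: scalar_diff algebra_simps)
  then have "cyc_sum x (insert c D) * alt_sum (insert c D) =
      cyc_sum x D * (scalar (x - of_nat (card D)) * alt_sum (insert c D))"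
    using insert.hyps by (simp add: cyc_sum_insert_right mult.assoc)
  also have "\<dots> = scalar (x - of_nat (card D)) * (cyc_sum x D * alt_sum D * (1 - ?J))"
    using insert.hyps by (simp add: alt_sum_insert_right scalar_left_commute' mult.assoc)
  also have "\<dots> = scalar (x - of_nat (card D)) * (scalar (\<Prod>i<card D. x - of_nat i) * alt_sum (insert c D))"
    using insert.hyps by (simp add: insert.IH alt_sum_insert_right mult.assoc)
  also have "\<dots> = scalar (\<Prod>i<card (insert c D). x - of_nat i) * alt_sum (insert c D)"
    using insert.hyps by (simp add: mult.commute flip: mult.assoc scalar_mult)
  finally show ?case .
qed simp

text \<open>The product of \<open>x\<close> plus the content over the cells of a hook with leg
  length \<open>b\<close> and arm length \<open>l\<close>: corner and leg have contents 0 down to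
  \<open>-b\<close>, the arm has contents 1 to \<open>l\<close>.\<close>

definition content_prod :: "'a::comm_ring_1 \<Rightarrow> nat \<Rightarrow> nat \<Rightarrow> 'a" where
  "content_prod x b l = (\<Prod>i<Suc b. x - of_nat i) * (\<Prod>j<l. x + of_nat (Suc j))"

text \<open>The arm is built up cell by cell, starting from the single column; every new cell
  multiplies the eigenvalue by \<open>x\<close> plus its content.\<close>

lemma cyc_sum_mult_hook:
  assumes "hook_partition A F m B"
  shows "cyc_sum x A * hook F m B =
    (scalar (content_prod x (card F) (card B)) * hook F m B :: ('b, 'a::field_char_0) galg)"
proof -
  have "finite B" using assms by (simp add: hook_partition_def)
  then show ?thesis
    using assms
  proof (induction B arbitrary: A rule: finite_induct)
    case empty
    then have "A = insert m F" "finite A" "card A = Suc (card F)"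
      by (auto simp: hook_partition_def)
    then show ?case
      using cyc_sum_mult_alt_sum[of A x] by (simp add: hook_def content_prod_def)
  next
    case (insert c B)
    define A' where "A' = insert m (F \<union> B)"
    have A': "hook_partition A' F m B" "c \<notin> A'" "A = insert c A'" "finite A'"
      using insert.hyps insert.prems by (auto simp: A'_def hook_partition_def)
    let ?h = "hook F m (insert c B) :: ('b, 'a) galg"
    have h: "?h = hook F m B * (1 + JM (insert m B) c)"
      by (rule hook_insert_right[OF A'(1,2)])
    have "(scalar x + JM A' c) * ?h = scalar (x + of_nat (Suc (card B))) * ?h"
      using JM_mult_hook_insert[OF A'(1,2), where 'a = 'a]
      by (simp add: scalar_add distrib_right del: of_nat_Suc)
    then have "cyc_sum x A * ?h = cyc_sum x A' * (scalar (x + of_nat (Suc (card B))) * ?h)"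
      using A' by (simp add: cyc_sum_insert_right mult.assoc)
    also have "\<dots> = scalar (x + of_nat (Suc (card B))) * (cyc_sum x A' * hook F m B * (1 + JM (insert m B) c))"
      by (simp only: h scalar_left_commute' mult.assoc)
    also have "\<dots> = scalar (x + of_nat (Suc (card B))) * (scalar (content_prod x (card F) (card B)) * ?h)"
      by (simp only: h insert.IH[OF A'(1)] mult.assoc)
    also have "\<dots> = scalar (content_prod x (card F) (card (insert c B))) * ?h"
    proof -
      have "content_prod x (card F) (card (insert c B)) =
          (x + of_nat (Suc (card B))) * content_prod x (card F) (card B)"
        using insert.hyps by (simp add: content_prod_def ac_simps)
      then show ?thesis
        by (simp only: scalar_mult mult.assoc)
    qed
    finally show ?case .
  qed
qed

lemma alt_sum_mult_subset:
  assumes "finite D" "F \<subseteq> D"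
  shows "alt_sum D * alt_sum F = (of_nat (fact (card F)) * alt_sum D :: ('b, 'a::comm_ring_1) galg)"
proof -
  have "finite F" using assms finite_subset by blast
  have "alt_sum D * (of_int (sign f) * gel f) = (alt_sum D :: ('b, 'a) galg)" if "f permutes F" for f
  proof -
    have "alt_sum D * (of_int (sign f) * gel f) = of_int (sign f) * (alt_sum D * gel f :: ('b, 'a) galg)"
      by (metis mult.assoc mult_of_int_commute)
    also have "\<dots> = of_int (sign f * sign f) * alt_sum D"
      by (simp only: gel_mult_alt_sum(2)[OF assms(1) permutes_subset[OF that assms(2)]]
          of_int_mult mult.assoc)
    finally show ?thesis by simp
  qed
  then have "alt_sum D * alt_sum F = (\<Sum>f | f permutes F. alt_sum D :: ('b, 'a) galg)"
    unfolding alt_sum_def[of F] sum_distrib_left by (intro sum.cong) auto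
  then show ?thesis
    using \<open>finite F\<close> by (simp add: card_permutations)
qed

lemma hook_mult_JM:
  assumes A: "hook_partition A F m B" and c: "c \<notin> A"
  shows "JM A c * hook F m B = (hook F m B * JM A c :: ('b, 'a::comm_ring_1) galg)"
proof -
  have "finite A" "insert m F \<subseteq> A" "insert m B \<subseteq> A"
    using A by (auto simp: hook_partition_def)
  then have "JM A c * alt_sum (insert m F) = (alt_sum (insert m F) * JM A c :: ('b, 'a) galg)"
    "JM A c * sym_sum (insert m B) = (sym_sum (insert m B) * JM A c :: ('b, 'a) galg)"
    using c by (auto intro: JM_commute_alt_sum JM_commute_sym_sum)
  then show ?thesis
    unfolding hook_def by (metis mult.assoc)
qed

text \<open>The element splits along the leg \<open>F\<close> and the row \<open>insert m B\<close>.
  The row part completes the symmetrizer of the longer arm, and what remains is the vector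
  \<open>hook F m B * (1 - JM F c)\<close> studied next.\<close>

lemma JM_mult_hook:
  assumes A: "hook_partition A F m B" and c: "c \<notin> A"
  shows "JM A c * hook F m B =
    (hook F m (insert c B) - hook F m B * (1 - JM F c) :: ('b, 'a::comm_ring_1) galg)"
proof -
  have "JM A c = JM F c + (JM (insert m B) c :: ('b, 'a) galg)"
    using A by (subst JM_union[symmetric]) (auto simp: hook_partition_def)
  then have "JM A c * hook F m B = (hook F m B * (JM F c + JM (insert m B) c) :: ('b, 'a) galg)"
    using hook_mult_JM[OF assms, where 'a = 'a] by simp
  then show ?thesis
    by (simp only: hook_insert_right[OF assms]) (simp add: algebra_simps)
qed

text \<open>After an antisymmetrizer on \<open>F\<close> the factor \<open>1 - JM F c\<close>
  completes the one on \<open>insert c F\<close>, on which \<open>JM F c\<close> acts by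
  \<open>- card F\<close>. The hook absorbs \<open>alt_sum F\<close> from the right up to a
  constant, so the same eigenvalue appears here.\<close>

lemma JM_mult_hook_alt:
  fixes A F B :: "'b set"
  assumes A: "hook_partition A F m B" and c: "c \<notin> A"
  defines "v \<equiv> hook F m B * (1 - JM F c) :: ('b, 'a::field_char_0) galg"
  shows "JM A c * v = hook F m (insert c B) * (1 - JM F c) - of_nat (Suc (card F)) * v"
proof -
  let ?h = "hook F m B :: ('b, 'a) galg" and ?J = "JM F c :: ('b, 'a) galg"
  define N where "N = (of_nat (fact (card F)) :: ('b, 'a) galg)"
  have fin: "finite F" "finite B" and disj: "F \<inter> B = {}" "m \<notin> F" "m \<notin> B" and c': "c \<notin> F"
    using A c by (auto simp: hook_partition_def)
  \<comment> \<open>The leg \<open>F\<close> avoids the row, so \<open>alt_sum F\<close> moves past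
    the row symmetrizer and is absorbed by the column antisymmetrizer with a factorial as
    factor.\<close>
  have absorb: "N * ?h = ?h * alt_sum F"
  proof -
    have "N * ?h = (N * alt_sum (insert m F)) * sym_sum (insert m B)"
      by (simp add: hook_def mult.assoc)
    also have "N * alt_sum (insert m F) = alt_sum (insert m F) * alt_sum F"
      using fin by (subst alt_sum_mult_subset) (auto simp: N_def)
    also have "alt_sum (insert m F) * alt_sum F * sym_sum (insert m B) = ?h * alt_sum F"
      unfolding hook_def mult.assoc
      by (subst alt_sum_commute_sym_sum) (use fin disj in auto)
    finally show ?thesis .
  qed
  \<comment> \<open>The identity is first proved after multiplication by \<open>N\<close>, which
    supplies the missing \<open>alt_sum F\<close>.\<close>
  have "N * (?h * ?J * (1 - ?J)) = ?h * (alt_sum F * ?J * (1 - ?J))"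
    by (simp add: absorb flip: mult.assoc)
  also have "alt_sum F * ?J * (1 - ?J) = ?J * alt_sum (insert c F)"
    using fin c' by (simp add: alt_sum_insert_right JM_commute_alt_sum flip: mult.assoc)
  also have "\<dots> = - of_nat (card F) * (alt_sum F * (1 - ?J))"
    using fin c' by (subst JM_mult_alt_sum) (auto simp: alt_sum_insert_right)
  also have "?h * \<dots> = - of_nat (card F) * (?h * alt_sum F * (1 - ?J))"
    by (simp add: of_nat_left_commute[of ?h] mult.assoc)
  also have "\<dots> = N * (- of_nat (card F) * v)"
    unfolding absorb[symmetric] v_def
    by (simp add: mult.assoc of_nat_left_commute[of N])
  finally have *: "N * (?h * ?J * (1 - ?J)) = N * (- of_nat (card F) * v)" .
  \<comment> \<open>In characteristic zero the factorial \<open>N\<close> is invertible and cancels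
    again.\<close>
  have inv: "scalar (1 / of_nat (fact (card F))) * N = 1"
    unfolding N_def by (simp del: of_nat_fact flip: scalar_mult scalar_of_nat)
  have hJ: "?h * ?J * (1 - ?J) = - of_nat (card F) * v"
    using arg_cong[OF *, of "\<lambda>r. scalar (1 / of_nat (fact (card F))) * r"] inv
    by (simp flip: mult.assoc)
  have "JM A c * v = (JM A c * ?h) * (1 - ?J)"
    by (simp add: v_def mult.assoc)
  also have "\<dots> = hook F m (insert c B) * (1 - ?J) - v + ?h * ?J * (1 - ?J)"
    by (simp add: JM_mult_hook[OF A c] v_def algebra_simps)
  also have "\<dots> = hook F m (insert c B) * (1 - ?J) - of_nat (Suc (card F)) * v"
    by (simp only: hJ) (simp add: algebra_simps)
  finally show ?thesis .
qed

text \<open>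
  The eigenvalue \<open>0\<close> belongs to the inner corner of the hook, the other two to the ends of its arm
  and leg.
\<close>

lemma JM_hook_cubic:
  assumes A: "hook_partition A F m B" and c: "c \<notin> A"
  defines "J \<equiv> JM A c :: ('b, 'a::field_char_0) galg"
  shows "J * ((J - of_nat (Suc (card B))) * ((J + of_nat (Suc (card F))) * hook F m B)) = 0"
proof -
  let ?a = "of_nat (Suc (card B)) :: ('b, 'a) galg" and ?b = "of_nat (Suc (card F)) :: ('b, 'a) galg"
  let ?h = "hook F m B :: ('b, 'a) galg" and ?h' = "hook F m (insert c B) :: ('b, 'a) galg"
  define v where "v = ?h * (1 - JM F c)"
  have 1: "(J - ?a) * ?h' = 0"
    using JM_mult_hook_insert[OF A c, where 'a = 'a] by (simp add: J_def algebra_simps)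
  have 2: "(J + ?b) * v = ?h' * (1 - JM F c)"
    using JM_mult_hook_alt[OF A c, where 'a = 'a] unfolding J_def v_def distrib_right by simp
  have 3: "J * ?h = ?h' - v"
    using JM_mult_hook[OF A c, where 'a = 'a] unfolding J_def v_def by simp
  have comm: "of_nat k * (J * r) = J * (of_nat k * r)" for k r
    by (rule of_nat_left_commute[symmetric])
  have ab: "of_nat k * (of_nat l * r) = of_nat l * (of_nat k * r :: ('b, 'a) galg)" for k l r
    by (rule of_nat_left_commute)
  \<comment> \<open>The factors commute, so \<open>J\<close> may act on \<open>?h\<close> first and
    produce \<open>?h' - v\<close>. Both terms then contain \<open>(J - ?a) * ?h'\<close>, the
    second because \<open>J + ?b\<close> takes \<open>v\<close> to a right multiple of
    \<open>?h'\<close>.\<close>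
  have "J * ((J - ?a) * ((J + ?b) * ?h)) = (J - ?a) * ((J + ?b) * (J * ?h))"
    by (simp add: algebra_simps comm)
  also have "\<dots> = (J - ?a) * ((J + ?b) * ?h') - (J - ?a) * ((J + ?b) * v)"
    by (simp add: 3 right_diff_distrib)
  also have "(J - ?a) * ((J + ?b) * ?h') = (J + ?b) * ((J - ?a) * ?h')"
    by (simp add: algebra_simps comm ab[of "card B"])
  also have "(J - ?a) * ((J + ?b) * v) = ((J - ?a) * ?h') * (1 - JM F c)"
    by (simp only: 2 mult.assoc)
  finally show ?thesis
    by (simp add: 1 del: of_nat_Suc)
qed

section \<open>Traces of hook symmetrizers and moments of the Jucys--Murphy element\<close>

lemma hook_expand:
  "hook F m B = (\<Sum>f | f permutes insert m F. \<Sum>g | g permutes insert m B.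
     of_int (sign f) * (gel f * gel g) :: ('b, 'a::comm_ring_1) galg)"
  by (simp add: hook_def alt_sum_def sym_sum_def sum_product mult.assoc)

text \<open>Column and row meet only in \<open>m\<close>, so a column permutation and a row
  permutation compose to the identity only if both are trivial. Hence exactly one term of the
  expanded symmetrizer contributes.\<close>

lemma tr_mult_hook:
  fixes r :: "('b, 'a::comm_ring_1) galg"
  assumes A: "hook_partition A F m B"
    and r: "\<And>f. f permutes A \<Longrightarrow> tr (r * gel f) = (if f = id then t else 0)"
  shows "tr (r * hook F m B) = t"
proof -
  have fin: "finite F" "finite B" and disj: "F \<inter> B = {}" "m \<notin> F" "m \<notin> B"
    using A by (auto simp: hook_partition_def)
  let ?P = "{f. f permutes insert m F}" and ?Q = "{g. g permutes insert m B}"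
  have *: "tr (r * (of_int (sign f) * (gel f * gel g))) = (if f = id \<and> g = id then t else 0)"
    if "f \<in> ?P" "g \<in> ?Q" for f g
  proof -
    have f: "f permutes insert m F" and g: "g permutes insert m B"
      using that by auto
    have fg: "permutation f" "permutation g"
      using f g fin permutation_permutes by blast+
    have fgA: "f \<circ> g permutes A"
      using f g A permutes_subset[of _ _ A] by (intro permutes_compose) (auto simp: hook_partition_def)
    have id: "f \<circ> g = id \<longleftrightarrow> f = id \<and> g = id"
    proof
      assume fg_id: "f \<circ> g = id"
      have "g x = x" for x
      proof (cases "x \<in> B")
        case True
        then have "f x = x"
          using f disj by (intro permutes_not_in[OF f]) auto
        then show ?thesis
          using fg_id permutes_inj[OF f] by (metis comp_apply id_apply injD)
      next
        case False
        show ?thesis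
        proof (cases "x = m")
          case True
          have "g m \<in> insert m B"
            using permutes_in_image[OF g, of m] by simp
          moreover have "g m \<notin> B"
          proof
            assume "g m \<in> B"
            then have "f (g m) = g m"
              using disj by (intro permutes_not_in[OF f]) auto
            then show False
              using fg_id \<open>g m \<in> B\<close> disj by (metis comp_apply id_apply)
          qed
          ultimately show ?thesis
            using True by simp
        next
          case False
          then show ?thesis
            using \<open>x \<notin> B\<close> by (intro permutes_not_in[OF g]) auto
        qed
      qed
      then have "g = id" by auto
      then show "f = id \<and> g = id" using fg_id by simp
    qed simp
    have "tr (r * (of_int (sign f) * (gel f * gel g))) = of_int (sign f) * tr (r * gel (f \<circ> g))"
      using tr_scalar[of "of_int (sign f)" "r * gel (f \<circ> g)"] fg
      by (simp add: gel_mult) (metis mult.assoc mult_of_int_commute)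
    then show ?thesis
      using r[OF fgA] id by auto
  qed
  have "tr (r * hook F m B) = (\<Sum>f\<in>?P. \<Sum>g\<in>?Q. if f = id \<and> g = id then t else 0)"
    unfolding hook_expand sum_distrib_left tr_sum by (intro sum.cong refl *)
  also have "\<dots> = (\<Sum>f\<in>?P. if f = id then t else 0)"
  proof (rule sum.cong)
    fix f
    have "finite ?Q" using fin by (simp add: finite_permutations)
    then show "(\<Sum>g\<in>?Q. if f = id \<and> g = id then t else 0) = (if f = id then t else 0)"
      by (cases "f = id") (simp_all add: permutes_id sum.delta)
  qed simp
  also have "\<dots> = t"
    using fin by (simp add: sum.delta finite_permutations permutes_id)
  finally show ?thesis .
qed

lemma tr_hook: "hook_partition A F m B \<Longrightarrow> tr (hook F m B :: ('b, 'a::comm_ring_1) galg) = 1"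
proof -
  assume A: "hook_partition A F m B"
  then have "finite A" by (auto simp: hook_partition_def)
  then have "tr (1 * gel f :: ('b, 'a) galg) = (if f = id then 1 else 0)" if "f permutes A" for f
    using that permutation_permutes tr_gel by (metis mult_1_left)
  from tr_mult_hook[OF A this] show ?thesis by simp
qed

text \<open>The first moment vanishes because \<open>f\<close> fixes \<open>c\<close>, and each
  transposition in \<open>JM A c\<close> then moves it.\<close>

lemma tr_JM_hook:
  assumes A: "hook_partition A F m B" and c: "c \<notin> A"
  shows "tr (JM A c * hook F m B :: ('b, 'a::comm_ring_1) galg) = 0"
proof (rule tr_mult_hook[OF A])
  fix f assume f: "f permutes A"
  have fin: "finite A" using A by (auto simp: hook_partition_def)
  then have perm: "permutation f"
    using f permutation_permutes by blast
  have "tr (gswap a c * gel f :: ('b, 'a) galg) = 0" if "a \<in> A" for a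
  proof -
    have "(Transposition.transpose a c \<circ> f) c = a"
      using f c by (simp add: permutes_not_in)
    then have "Transposition.transpose a c \<circ> f \<noteq> id"
      using that c by (metis id_apply)
    then show ?thesis
      using perm by (simp add: gel_mult tr_gel permutation_compose)
  qed
  then show "tr (JM A c * gel f :: ('b, 'a) galg) = (if f = id then 0 else 0)"
    by (simp add: JM_def sum_distrib_right tr_sum)
qed

text \<open>For the second moment, the product of the two transpositions must fix \<open>c\<close>,
  which forces them to be equal; they then cancel, and there is one such pair for each point of
  \<open>A\<close>.\<close>

lemma tr_JM_JM_hook:
  assumes A: "hook_partition A F m B" and c: "c \<notin> A"
  shows "tr (JM A c * (JM A c * hook F m B) :: ('b, 'a::comm_ring_1) galg) = of_nat (card A)"
  unfolding mult.assoc[symmetric]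
proof (rule tr_mult_hook[OF A])
  fix f assume f: "f permutes A"
  have fin: "finite A" using A by (auto simp: hook_partition_def)
  then have perm: "permutation f"
    using f permutation_permutes by blast
  have *: "tr (gswap a c * gswap b c * gel f :: ('b, 'a) galg) =
      (if a = b \<and> f = id then 1 else 0)" if "a \<in> A" "b \<in> A" for a b
  proof -
    have "(Transposition.transpose a c \<circ> Transposition.transpose b c \<circ> f) c = Transposition.transpose a c b"
      using f c by (simp add: permutes_not_in)
    moreover have "Transposition.transpose a c b = c \<longleftrightarrow> a = b"
      using that c by (auto simp: transpose_def)
    ultimately have "Transposition.transpose a c \<circ> Transposition.transpose b c \<circ> f = id \<Longrightarrow> a = b"
      by auto
    then have "Transposition.transpose a c \<circ> Transposition.transpose b c \<circ> f = id \<longleftrightarrow> a = b \<and> f = id"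
      by (auto simp: fun_eq_iff)
    then show ?thesis
      using perm by (simp add: gel_mult tr_gel permutation_compose)
  qed
  have "tr (JM A c * JM A c * gel f :: ('b, 'a) galg) = (\<Sum>a\<in>A. \<Sum>b\<in>A. if a = b \<and> f = id then 1 else 0)"
    unfolding JM_def sum_distrib_right unfolding sum_distrib_left sum_distrib_right tr_sum
    by (intro sum.cong refl *)
  also have "\<dots> = (if f = id then of_nat (card A) else 0)"
    using fin by simp
  finally show "tr (JM A c * JM A c * gel f :: ('b, 'a) galg) = (if f = id then of_nat (card A) else 0)" .
qed

lemma prod_list_eigenvector:
  fixes r :: "('b, 'a::field_char_0) galg"
  assumes "\<And>x. x \<in> set xs \<Longrightarrow> Z x * r = scalar (z x) * r"
  shows "prod_list (map Z xs) * r = scalar (prod_list (map z xs)) * r"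
  using assms
proof (induction xs)
  case (Cons x xs)
  have "prod_list (map Z (x # xs)) * r = Z x * (scalar (prod_list (map z xs)) * r)"
    using Cons by (simp add: mult.assoc)
  also have "\<dots> = scalar (prod_list (map z xs)) * (scalar (z x) * r)"
    unfolding scalar_left_commute'[of "Z x"] using Cons.prems by simp
  finally show ?case
    by (simp add: mult.commute flip: mult.assoc scalar_mult)
qed simp

text \<open>By the cubic equation the hook is a combination of three eigenvectors of the
  Jucys--Murphy element, for \<open>a\<close>, \<open>- b\<close> and 0. On each of them every
  factor \<open>cyc_sum x (insert c A)\<close> acts as a scalar, so the product is evaluated
  eigenvector by eigenvector.\<close>

lemma tr_cyc_sum_prod_hook:
  fixes xs :: "'a::field_char_0 list"
  assumes A: "hook_partition A F m B" and c: "c \<notin> A"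
  defines "a \<equiv> of_nat (Suc (card B))" and "b \<equiv> of_nat (Suc (card F))" and "N \<equiv> of_nat (card A)"
  defines "u \<equiv> \<lambda>y. prod_list (map (\<lambda>x. (x + y) * content_prod x (card F) (card B)) xs)"
  shows "a * b * (a + b) * tr (prod_list (map (\<lambda>x. cyc_sum x (insert c A)) xs) * hook F m B) =
    N * (b * u a + a * u (- b)) + (a + b) * (a * b - N) * u 0"
proof -
  let ?J = "JM A c :: ('b, 'a) galg" and ?h = "hook F m B :: ('b, 'a) galg"
  let ?a = "scalar a :: ('b, 'a) galg" and ?b = "scalar b :: ('b, 'a) galg"
  let ?P = "prod_list (map (\<lambda>x. cyc_sum x (insert c A)) xs) :: ('b, 'a) galg"
  \<comment> \<open>Each vector applies the cubic with one factor left out, so the omitted factor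
    annihilates it.\<close>
  define ea where "ea = ?J * ((?J + ?b) * ?h)"
  define eb where "eb = ?J * ((?J - ?a) * ?h)"
  define e0 where "e0 = (?J - ?a) * ((?J + ?b) * ?h)"
  have fin: "finite A" using A by (auto simp: hook_partition_def)
  have ab: "?a = of_nat (Suc (card B))" "?b = of_nat (Suc (card F))"
    unfolding a_def b_def by (rule scalar_of_nat)+
  have comm: "scalar y * (?J * r) = ?J * (scalar y * r)" for y r
    by (rule scalar_left_commute'[symmetric])
  have comm': "?b * (?a * r) = ?a * (?b * r)" for r
    by (rule scalar_left_commute')
  have cubic: "?J * ((?J - ?a) * ((?J + ?b) * ?h)) = 0"
    unfolding ab by (rule JM_hook_cubic[OF A c])
  have "(?J - ?a) * ea = 0" "(?J + ?b) * eb = 0" "?J * e0 = 0"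
    using cubic unfolding ea_def eb_def e0_def
    by (simp_all add: algebra_simps comm comm')
  then have eig: "?J * ea = scalar a * ea" "?J * eb = scalar (- b) * eb" "?J * e0 = scalar 0 * e0"
    by (simp_all add: algebra_simps scalar_minus eq_neg_iff_add_eq_0)
  \<comment> \<open>Since \<open>cyc_sum x A\<close> commutes with \<open>?J\<close>, its eigenvalue
    on \<open>?h\<close> carries over to all three vectors.\<close>
  have Zcomm: "cyc_sum x A * (?J * r) = ?J * (cyc_sum x A * r)" for x r
    using JM_commute_cyc_sum[OF fin c order_refl, of x] by (simp flip: mult.assoc)
  have Z: "cyc_sum x A * e = scalar (content_prod x (card F) (card B)) * e" if "e \<in> {ea, eb, e0}" for x e
  proof -
    let ?z = "scalar (content_prod x (card F) (card B)) :: ('b, 'a) galg"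
    have h: "cyc_sum x A * ?h = ?z * ?h"
      by (rule cyc_sum_mult_hook[OF A])
    have J: "cyc_sum x A * (?J * r) = ?z * (?J * r)" if "cyc_sum x A * r = ?z * r" for r
      using that by (simp add: Zcomm scalar_left_commute'[of ?J])
    have s: "cyc_sum x A * (scalar y * r) = ?z * (scalar y * r)" if "cyc_sum x A * r = ?z * r" for y r
      unfolding scalar_left_commute'[of _ y] that by simp
    show ?thesis
      using \<open>e \<in> _\<close> unfolding ea_def eb_def e0_def
      by (auto simp: distrib_right left_diff_distrib distrib_left right_diff_distrib J s h)
  qed
  have P: "?P * e = scalar (u y) * e" if "?J * e = scalar y * e" "e \<in> {ea, eb, e0}" for y e
    unfolding u_def
  proof (rule prod_list_eigenvector)
    fix x
    have "cyc_sum x (insert c A) * e = (scalar x + ?J) * (cyc_sum x A * e)"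
      using fin c by (simp add: cyc_sum_insert_left mult.assoc)
    also have "\<dots> = scalar (content_prod x (card F) (card B)) * ((scalar x + ?J) * e)"
      unfolding Z[OF that(2)] by (rule scalar_left_commute')
    also have "(scalar x + ?J) * e = scalar (x + y) * e"
      by (simp add: distrib_right that(1) scalar_add)
    finally show "cyc_sum x (insert c A) * e = scalar ((x + y) * content_prod x (card F) (card B)) * e"
      by (simp add: mult.commute flip: mult.assoc scalar_mult)
  qed
  \<comment> \<open>Lagrange interpolation of the constant 1 at the nodes \<open>a\<close>,
    \<open>- b\<close> and 0, with denominators cleared.\<close>
  have "scalar (a * b * (a + b)) * ?h = scalar b * ea + scalar a * eb - scalar (a + b) * e0"
    unfolding ea_def eb_def e0_def
    by (simp add: algebra_simps scalar_mult scalar_add comm comm')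
  then have "scalar (a * b * (a + b)) * (?P * ?h) =
      scalar b * (?P * ea) + scalar a * (?P * eb) - scalar (a + b) * (?P * e0)"
    by (simp add: distrib_left right_diff_distrib flip: scalar_left_commute'[of ?P])
  then have "tr (scalar (a * b * (a + b)) * (?P * ?h)) =
      tr (scalar b * (scalar (u a) * ea) + scalar a * (scalar (u (- b)) * eb) -
        scalar (a + b) * (scalar (u 0) * e0))"
    using P[OF eig(1)] P[OF eig(2)] P[OF eig(3)] by simp
  then have main: "a * b * (a + b) * tr (?P * ?h) =
      b * (u a * tr ea) + a * (u (- b) * tr eb) - (a + b) * (u 0 * tr e0)"
    by (simp add: tr_add tr_diff tr_scalar)
  \<comment> \<open>The eigenvectors are quadratic in \<open>?J\<close>, so the moments of order 0,
    1 and 2 determine their traces.\<close>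
  have trs: "tr ?h = 1" "tr (?J * ?h) = 0" "tr (?J * (?J * ?h)) = N"
    using tr_hook[OF A] tr_JM_hook[OF A c] tr_JM_JM_hook[OF A c] by (simp_all add: N_def)
  have tea: "tr ea = N" "tr eb = N"
    unfolding ea_def eb_def
    by (simp_all add: distrib_right left_diff_distrib distrib_left right_diff_distrib
        scalar_left_commute'[of ?J] tr_add tr_diff tr_scalar trs)
  have te0: "tr e0 = N - a * b"
    unfolding e0_def
    by (simp add: distrib_right left_diff_distrib distrib_left right_diff_distrib
        scalar_left_commute'[of ?J] tr_add tr_diff tr_scalar trs)
  show ?thesis
    unfolding main tea te0 by (simp add: algebra_simps)
qed

section \<open>Class functions at a long cycle\<close>

lemma tr_mult_conj:
  fixes r :: "('b, 'a::comm_ring_1) galg"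
  assumes g: "permutation g" and r: "gel g * r = r * gel g" and X: "gel g * X = Y * gel g"
  shows "tr (r * X) = tr (r * Y)"
proof -
  have ig: "permutation (inv' g)"
    using g by (rule permutation_inverse)
  have 1: "gel (inv' g) * gel g = (1 :: ('b, 'a) galg)" "gel g * gel (inv' g) = (1 :: ('b, 'a) galg)"
    using g ig permutation_inverse_works[OF g] by (simp_all add: gel_mult)
  have "tr (r * Y) = tr (r * (Y * gel g * gel (inv' g)))"
    by (simp add: 1 mult.assoc)
  also have "\<dots> = tr (r * gel g * X * gel (inv' g))"
    by (simp add: X[symmetric] mult.assoc)
  also have "\<dots> = tr (gel g * r * X * gel (inv' g))"
    by (simp add: r)
  also have "\<dots> = tr (gel (inv' g) * (gel g * r * X))"
    by (rule tr_commute)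
  also have "\<dots> = tr (r * X)"
    by (simp add: 1 flip: mult.assoc)
  finally show ?thesis by simp
qed

lemma tr_alt_transpose_sym_conj:
  fixes r :: "('b, 'a::comm_ring_1) galg"
  assumes fin: "finite D" "finite E" and r: "\<And>g. g permutes A \<Longrightarrow> gel g * r = r * gel g"
    and g: "g permutes A" "finite A" "g ` D = D" "g ` E = E"
  shows "tr (r * (alt_sum D * (gswap a y * sym_sum E))) =
    tr (r * (alt_sum D * (gswap (g a) (g y) * sym_sum E)))"
proof (rule tr_mult_conj)
  show perm: "permutation g"
    using g permutation_permutes by blast
  show "gel g * r = r * gel g"
    using r g by simp
  have "gel g * (alt_sum D * (gswap a y * sym_sum E)) =
      alt_sum D * ((gel g * gswap a y) * sym_sum E :: ('b, 'a) galg)"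
    using gel_conj_alt_sum[OF fin(1) perm, where 'a = 'a] g by (metis mult.assoc)
  also have "\<dots> = alt_sum D * (gswap (g a) (g y) * (gel g * sym_sum E))"
    using g by (simp add: gel_transpose_commute mult.assoc)
  also have "gel g * sym_sum E = (sym_sum E * gel g :: ('b, 'a) galg)"
    using gel_conj_sym_sum[OF fin(2) perm, where 'a = 'a] g by simp
  finally show "gel g * (alt_sum D * (gswap a y * sym_sum E)) =
      alt_sum D * (gswap (g a) (g y) * sym_sum E) * (gel g :: ('b, 'a) galg)"
    by (simp add: mult.assoc)
qed

text \<open>Exchanging \<open>a\<close> with \<open>a'\<close> and \<open>y\<close> with
  \<open>y'\<close> preserves \<open>D\<close> and \<open>E\<close>, hence commutes with both sums,
  and conjugates one transposition into the other; \<open>r\<close> and the trace do not notice the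
  conjugation.\<close>

lemma tr_alt_transpose_sym_const:
  fixes r :: "('b, 'a::comm_ring_1) galg"
  assumes fin: "finite D" "finite E" and disj: "D \<inter> E = {}"
    and r: "\<And>g. g permutes D \<union> E \<Longrightarrow> gel g * r = r * gel g"
    and "a \<in> D" "a' \<in> D" "y \<in> E" "y' \<in> E"
  shows "tr (r * (alt_sum D * (gswap a y * sym_sum E))) =
    tr (r * (alt_sum D * (gswap a' y' * sym_sum E)))"
proof -
  let ?g = "Transposition.transpose a a' \<circ> Transposition.transpose y y'"
  have D: "?g z \<in> D" if "z \<in> D" for z
    using that assms by (auto simp: transpose_def)
  have E: "?g z \<in> E" if "z \<in> E" for z
    using that assms by (auto simp: transpose_def)
  have perm: "?g permutes D \<union> E"
    using assms by (intro permutes_compose permutes_swap_id) auto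
  have inj: "inj ?g"
    using perm by (rule permutes_inj)
  have "?g ` D = D" "?g ` E = E"
    using D E fin inj by (metis endo_inj_surj image_subsetI inj_on_subset subset_UNIV)+
  moreover have "?g a = a'" "?g y = y'"
    using assms by (auto simp: transpose_def)
  ultimately show ?thesis
    using tr_alt_transpose_sym_conj[OF fin r perm, of a y] fin by simp
qed

text \<open>
  Modulo commutators, both \<open>hook F c (insert m B)\<close> and \<open>hook (insert c F) m B\<close> are combinations
  of the product of the antisymmetrizer on \<open>insert c F\<close> with the symmetrizer on \<open>insert m B\<close>, and
  of the same product with a transposition between the two sets inserted in the middle.
\<close>

lemma tr_central_JM_hook:
  fixes r :: "('b, 'a::field_char_0) galg"
  assumes A: "hook_partition A F m B" and c: "c \<notin> A"
    and r: "\<And>g. g permutes insert c A \<Longrightarrow> gel g * r = r * gel g"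
    and t: "\<And>F m B. hook_partition (insert c A) F m B \<Longrightarrow> tr (r * hook F m B) = t (card F)"
  shows "of_nat (Suc (card A)) * tr (r * JM A c * hook F m B) =
    of_nat (card A) * (t (card F) - t (Suc (card F)))"
proof -
  have fin: "finite F" "finite B" "finite A" and disj: "F \<inter> B = {}" "m \<notin> F" "m \<notin> B" and
    A_eq: "A = insert m (F \<union> B)" and c': "c \<noteq> m" "c \<notin> F" "c \<notin> B"
    using A c by (auto simp: hook_partition_def)
  have cardA: "card A = Suc (card F + card B)"
    unfolding A_eq using fin disj by (simp add: card_Un_disjoint)
  let ?p = "hook F m B :: ('b, 'a) galg" and ?s = "sym_sum (insert m B) :: ('b, 'a) galg"
  let ?e = "alt_sum (insert c F) :: ('b, 'a) galg"
  define q where "q = tr (r * (?e * (gswap c m * ?s)))"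
  define h where "h = tr (r * (?e * ?s))"
  have q: "tr (r * (?e * (gswap a y * ?s))) = q"
    if "a \<in> insert c F" "y \<in> insert m B" for a y
    unfolding q_def
  proof (rule tr_alt_transpose_sym_const)
    fix g assume "g permutes insert c F \<union> insert m B"
    moreover have "insert c F \<union> insert m B = insert c A"
      using A_eq by auto
    ultimately show "gel g * r = r * gel g"
      using r by simp
  qed (use that fin disj c' in auto)
  have tB: "tr (r * hook F m (insert c B)) = t (card F)"
    by (rule t) (use A c' in \<open>auto simp: hook_partition_def\<close>)
  have tF: "tr (r * hook (insert c F) m B) = t (Suc (card F))"
    using t[of "insert c F" m B] A c' fin by (auto simp: hook_partition_def insert_commute)
  have "t (Suc (card F)) = tr (r * (alt_sum (insert m (insert c F)) * ?s))"
    using tF by (simp add: hook_def)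
  also have "alt_sum (insert m (insert c F)) = ?e * (1 - JM (insert c F) m)"
    using fin disj c' by (intro alt_sum_insert_right) auto
  also have "tr (r * (?e * (1 - JM (insert c F) m) * ?s)) =
      h - (\<Sum>a\<in>insert c F. tr (r * (?e * (gswap a m * ?s))))"
    by (simp add: h_def JM_def algebra_simps sum_distrib_left sum_distrib_right tr_diff tr_sum del: sum.insert sum.insert_if)
  also have "\<dots> = h - of_nat (Suc (card F)) * q"
    using q fin c' by (simp del: sum.insert sum.insert_if)
  finally have 1: "t (Suc (card F)) = h - of_nat (Suc (card F)) * q" .
  \<comment> \<open>The same hook shape as in \<open>tB\<close>, but with \<open>c\<close> at the
    corner, so that its column is \<open>insert c F\<close> and the antisymmetrizer is
    \<open>?e\<close>.\<close>
  have "t (card F) = tr (r * hook F c (insert m B))"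
    by (rule t[symmetric]) (use A c' in \<open>auto simp: hook_partition_def\<close>)
  also have "\<dots> = tr (r * (?e * sym_sum (insert c (insert m B))))"
    by (simp add: hook_def)
  also have "sym_sum (insert c (insert m B)) = (1 + JM (insert m B) c) * ?s"
    using fin disj c' by (intro sym_sum_insert_left) auto
  also have "tr (r * (?e * ((1 + JM (insert m B) c) * ?s))) =
      h + (\<Sum>a\<in>insert m B. tr (r * (?e * (gswap a c * ?s))))"
    by (simp add: h_def JM_def algebra_simps sum_distrib_left sum_distrib_right tr_add tr_sum del: sum.insert sum.insert_if)
  also have "\<dots> = h + (\<Sum>a\<in>insert m B. q)"
    using q by (subst transpose_commute) (simp del: sum.insert sum.insert_if)
  also have "\<dots> = h + of_nat (Suc (card B)) * q"
    using fin disj by (simp del: sum.insert sum.insert_if)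
  finally have 2: "t (card F) = h + of_nat (Suc (card B)) * q" .
  \<comment> \<open>Subtracting \<open>1\<close> from \<open>2\<close> eliminates \<open>h\<close>;
    the coefficients of \<open>q\<close> add up to the number of points of
    \<open>insert c A\<close>.\<close>
  have Nq: "of_nat (Suc (card A)) * q = t (card F) - t (Suc (card F))"
    unfolding 1 2 cardA by (simp add: algebra_simps)
  have rJ: "(1 - JM F c) * r = r * (1 - JM F c)"
  proof -
    have "gswap a c * r = r * gswap a c" if "a \<in> F" for a
      using that A_eq by (intro r permutes_swap_id) auto
    then have "JM F c * r = r * JM F c"
      by (simp add: JM_def sum_distrib_left sum_distrib_right)
    then show ?thesis
      by (simp add: algebra_simps)
  qed
  \<comment> \<open>The right factor is moved around the trace and through \<open>r\<close>, so that
    it meets the column antisymmetrizer from the left.\<close>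
  have "tr (r * (?p * (1 - JM F c))) = tr ((1 - JM F c) * r * ?p)"
    using tr_commute[of "r * ?p" "1 - JM F c"] by (simp only: mult.assoc)
  also have "\<dots> = tr (r * ((1 - JM F c) * ?p))"
    by (simp only: rJ mult.assoc)
  also have "(1 - JM F c) * ?p = hook (insert c F) m B + ?e * (gswap c m * ?s)"
  proof -
    have "1 - JM F c = (1 - JM (insert m F) c) + (gswap m c :: ('b, 'a) galg)"
      using fin disj by (simp add: JM_insert)
    then have "(1 - JM F c) * ?p = (1 - JM (insert m F) c) * alt_sum (insert m F) * ?s +
        gswap m c * alt_sum (insert m F) * ?s"
      by (simp only: hook_def distrib_right mult.assoc)
    also have "(1 - JM (insert m F) c) * alt_sum (insert m F) = (alt_sum (insert c (insert m F)) :: ('b, 'a) galg)"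
      using fin c' by (intro alt_sum_insert_left[symmetric]) auto
    also have "gswap m c * alt_sum (insert m F) =
        alt_sum (Transposition.transpose m c ` insert m F) * (gswap m c :: ('b, 'a) galg)"
      using fin by (intro gel_conj_alt_sum) auto
    also have "Transposition.transpose m c ` insert m F = insert c F"
      using disj c' by (auto simp: transpose_def image_iff)
    finally show ?thesis
      by (simp add: hook_def insert_commute transpose_commute[of m] mult.assoc)
  qed
  also have "tr (r * (hook (insert c F) m B + ?e * (gswap c m * ?s))) = t (Suc (card F)) + q"
    by (simp add: distrib_left tr_add tF q_def)
  finally have v: "tr (r * (?p * (1 - JM F c))) = t (Suc (card F)) + q" .
  have "tr (r * JM A c * ?p) = tr (r * (hook F m (insert c B) - ?p * (1 - JM F c)))"
    by (simp only: mult.assoc JM_mult_hook[OF A c])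
  also have "\<dots> = t (card F) - t (Suc (card F)) - q"
    by (simp add: right_diff_distrib[of r] tr_diff tB v)
  finally have "of_nat (Suc (card A)) * tr (r * JM A c * ?p) =
      of_nat (Suc (card A)) * (t (card F) - t (Suc (card F))) - of_nat (Suc (card A)) * q"
    by (simp only: right_diff_distrib)
  then show ?thesis
    unfolding Nq by (simp add: algebra_simps)
qed

text \<open>Pascal's rule: an alternating binomial sum of differences of \<open>t\<close> is the
  next alternating binomial sum of \<open>t\<close> itself.\<close>

lemma alternating_binomial_sum_Suc:
  fixes t :: "nat \<Rightarrow> 'a::comm_ring_1"
  shows "(\<Sum>b\<le>M. (-1) ^ b * of_nat (M choose b) * (t b - t (Suc b))) =
    (\<Sum>b\<le>Suc M. (-1) ^ b * of_nat (Suc M choose b) * t b)"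
proof -
  have "(\<Sum>b\<le>M. (-1) ^ b * of_nat (M choose b) * t b) = (\<Sum>b\<le>Suc M. (-1) ^ b * of_nat (M choose b) * t b)"
    by (simp add: binomial_eq_0)
  also have "\<dots> = t 0 - (\<Sum>b\<le>M. (-1) ^ b * of_nat (M choose Suc b) * t (Suc b))"
    by (simp only: sum.atMost_Suc_shift) (simp add: sum_negf)
  finally show ?thesis
    by (simp only: sum.atMost_Suc_shift) (simp add: algebra_simps sum_subtractf sum.distrib sum_negf)
qed

text \<open>In terms of characters, the weight of leg length \<open>b\<close> is the dimension
  \<open>M choose b\<close> of the hook representation times its character, a sign, at a long cycle;
  shapes other than hooks have character 0 there. The proof is an induction that removes the first
  point \<open>c\<close> of the cycle and passes from \<open>r\<close> to \<open>r\<close> times the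
  Jucys--Murphy element of \<open>c\<close>.\<close>

lemma tr_long_cycle:
  fixes r :: "('b, 'a::field_char_0) galg"
  assumes "distinct cs" "length cs = Suc M"
    and "\<And>g. g permutes set cs \<Longrightarrow> gel g * r = r * gel g"
    and "\<And>F m B. hook_partition (set cs) F m B \<Longrightarrow> tr (r * hook F m B) = t (card F)"
  shows "fact (Suc M) * tr (r * gel (inv' (cycle_of_list cs))) =
    (\<Sum>b\<le>M. (-1) ^ b * of_nat (M choose b) * t b)"
  using assms
proof (induction M arbitrary: cs r t)
  case 0
  then obtain m where cs: "cs = [m]"
    by (metis length_0_conv length_Suc_conv)
  have "tr (r * hook {} m {}) = t (card ({} :: 'b set))"
    by (rule "0.prems"(4)) (simp add: hook_partition_def cs)
  then show ?case
    by (simp add: cs hook_def gel_id[unfolded id_def])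
next
  case (Suc M)
  then obtain c d ds where cs: "cs = c # d # ds"
    by (metis length_Suc_conv)
  let ?A = "set (d # ds)" and ?s = "cycle_of_list (d # ds)"
  have cA: "c \<notin> ?A" "set cs = insert c ?A" "distinct (d # ds)" "length (d # ds) = Suc M" "finite ?A"
    using Suc.prems by (auto simp: cs)
  have cardA: "card ?A = Suc M"
    using cA(3,4) distinct_card by metis
  have perm: "permutation ?s"
    by (rule permutation_of_cycle)
  have iperm: "permutation (inv' ?s)"
    using perm by (rule permutation_inverse)
  have s_inv: "?s \<circ> inv' ?s = id" "inv' ?s \<circ> ?s = id"
    using permutation_inverse_works[OF perm] by auto
  have inv_cs: "inv' (cycle_of_list cs) = inv' ?s \<circ> Transposition.transpose d c"
  proof -
    have "inv' (cycle_of_list cs) = inv' ?s \<circ> inv' (Transposition.transpose c d)"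
      unfolding cs cycle_of_list.simps
      by (rule o_inv_distrib) (use perm in \<open>auto intro: permutation_bijective\<close>)
    then show ?thesis
      by (simp add: transpose_commute)
  qed
  have r: "gel g * r = r * gel g" if "g permutes insert c ?A" for g
    using Suc.prems(3) that cA(2) by simp
  \<comment> \<open>The power of \<open>?s\<close> that takes \<open>d\<close> to \<open>a\<close>
    commutes with \<open>?s\<close> and fixes \<open>c\<close>. Conjugation by it shows that all
    transpositions of \<open>c\<close> with a point of \<open>?A\<close> contribute the same
    trace.\<close>
  have conj: "tr (r * (gel (inv' ?s) * gswap a c)) = tr (r * gel (inv' (cycle_of_list cs)))"
    if aA: "a \<in> ?A" for a
  proof -
    obtain i where i: "i < length (d # ds)" "a = (d # ds) ! i"
      using aA by (metis in_set_conv_nth)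
    let ?g = "?s ^^ i"
    have "map ?g (d # ds) = rotate i (d # ds)"
      by (rule cyclic_rotation) (rule cA(3))
    then have "?g d # map ?g ds = rotate i (d # ds)"
      by (simp only: list.map)
    then have "?g d = hd (rotate i (d # ds))"
      by (metis list.sel(1))
    then have gd: "?g d = a"
      using i by (simp only: hd_rotate_conv_nth list.distinct not_False_eq_True mod_less)
    have gA: "?g permutes ?A"
    proof (induction i)
      case (Suc i)
      then show ?case
        using permutes_compose[OF Suc cycle_permutes[of "d # ds"]] by (simp only: funpow.simps)
    qed (simp only: funpow.simps permutes_id)
    then have gcA: "?g permutes insert c ?A"
      by (rule permutes_subset) auto
    have pg: "permutation ?g"
      using gA cA(5) permutation_permutes by blast
    have gc: "?g c = c"
      using gA cA(1) by (rule permutes_not_in)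
    have "?g \<circ> inv' ?s = inv' ?s \<circ> ?g"
    proof -
      have "?s \<circ> ?g = ?g \<circ> ?s"
        by (simp only: fun_eq_iff comp_apply funpow_swap1 simp_thms)
      then have "inv' ?s \<circ> (?s \<circ> ?g) \<circ> inv' ?s = inv' ?s \<circ> (?g \<circ> ?s) \<circ> inv' ?s"
        by simp
      then show ?thesis
        by (simp only: comp_assoc s_inv comp_id) (simp only: s_inv id_comp flip: comp_assoc)
    qed
    then have 1: "gel ?g * gel (inv' ?s) = (gel (inv' ?s) * gel ?g :: ('b, 'a) galg)"
      using pg iperm by (simp add: gel_mult)
    have "gel ?g * (gel (inv' ?s) * gswap d c) =
        gel (inv' ?s) * (gel ?g * gswap d c :: ('b, 'a) galg)"
      by (simp only: 1 mult.assoc[symmetric])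
    also have "gel ?g * gswap d c = (gswap a c * gel ?g :: ('b, 'a) galg)"
      using gel_transpose_commute[OF gA cA(5), of d c] gd gc by simp
    finally have "tr (r * (gel (inv' ?s) * gswap d c)) =
        tr (r * (gel (inv' ?s) * gswap a c))"
      using pg r[OF gcA] by (intro tr_mult_conj) (simp_all add: mult.assoc)
    then show ?thesis
      using iperm by (simp add: inv_cs gel_mult)
  qed
  define T where "T = tr (r * gel (inv' (cycle_of_list cs)))"
  let ?r = "r * JM ?A c"
  have rJ: "JM ?A c * r = r * JM ?A c"
  proof -
    have "gswap a c * r = r * gswap a c" if "a \<in> ?A" for a
      using that by (intro r permutes_swap_id) auto
    then show ?thesis
      unfolding JM_def sum_distrib_left sum_distrib_right by (intro sum.cong refl)
  qed
  have NT: "tr (?r * gel (inv' ?s)) = of_nat (Suc M) * T"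
  proof -
    have "tr (?r * gel (inv' ?s)) = tr (JM ?A c * (r * gel (inv' ?s)))"
      by (simp only: rJ[symmetric] mult.assoc)
    also have "\<dots> = tr (r * (gel (inv' ?s) * JM ?A c))"
      by (subst tr_commute) (simp only: mult.assoc)
    also have "\<dots> = (\<Sum>a\<in>?A. T)"
      unfolding JM_def sum_distrib_left tr_sum T_def by (intro sum.cong refl conj)
    finally show ?thesis
      using cardA by simp
  qed
  \<comment> \<open>The hook values of \<open>?r\<close> on the smaller set, as computed by
    \<open>tr_central_JM_hook\<close>.\<close>
  define t' where "t' = (\<lambda>b. of_nat (Suc M) / of_nat (Suc (Suc M)) * (t b - t (Suc b)))"
  have IH: "fact (Suc M) * tr (?r * gel (inv' ?s)) = (\<Sum>b\<le>M. (-1) ^ b * of_nat (M choose b) * t' b)"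
  proof (rule Suc.IH)
    fix g assume g: "g permutes ?A"
    then have "gel g * JM ?A c = (JM ?A c * gel g :: ('b, 'a) galg)"
      using cA by (intro JM_commute_gel) auto
    moreover have "gel g * r = r * gel g"
      by (rule r, rule permutes_subset[OF g]) auto
    ultimately show "gel g * ?r = ?r * gel g"
      by (metis mult.assoc)
  next
    fix F m B assume A: "hook_partition ?A F m B"
    have "of_nat (Suc (card ?A)) * tr (?r * hook F m B) =
        of_nat (card ?A) * (t (card F) - t (Suc (card F)))"
      using Suc.prems(4) cA(2) by (intro tr_central_JM_hook[OF A cA(1) r]) auto
    then show "tr (?r * hook F m B) = t' (card F)"
      unfolding t'_def cardA by (simp add: field_simps del: of_nat_Suc)
  qed (use cA in auto)
  have "of_nat (Suc M) * (fact (Suc (Suc M)) * T) = of_nat (Suc (Suc M)) * (fact (Suc M) * tr (?r * gel (inv' ?s)))"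
    unfolding NT by (simp only: fact_Suc of_nat_mult ac_simps)
  also have "\<dots> = (\<Sum>b\<le>M. of_nat (Suc M) * ((-1) ^ b * of_nat (M choose b) * (t b - t (Suc b))))"
    unfolding IH sum_distrib_left t'_def by (intro sum.cong) (simp_all add: field_simps del: of_nat_Suc)
  also have "\<dots> = of_nat (Suc M) * (\<Sum>b\<le>Suc M. (-1) ^ b * of_nat (Suc M choose b) * t b)"
    unfolding sum_distrib_left[symmetric] alternating_binomial_sum_Suc by (rule refl)
  finally show ?case
    unfolding T_def by (simp del: of_nat_Suc)
qed

section \<open>Transitive factorizations as coefficients\<close>

lemma tuple_product_Suc: "tuple_product (Suc k) \<pi> = tuple_product k \<pi> \<circ> \<pi> (Suc k)"
proof -
  have "foldr (\<circ>) fs g = foldr (\<circ>) fs id \<circ> g" for fs :: "(nat \<Rightarrow> nat) list" and g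
    by (induction fs) (simp_all add: comp_assoc)
  from this[of "map \<pi> [1..<Suc k]" "\<pi> (Suc k)"] show ?thesis
    by (simp add: tuple_product_def)
qed

lemma tuple_product_cong: "(\<And>i. i \<in> {1..k} \<Longrightarrow> \<pi> i = \<rho> i) \<Longrightarrow> tuple_product k \<pi> = tuple_product k \<rho>"
  by (induction k) (simp_all add: tuple_product_Suc, simp add: tuple_product_def)

lemma permutation_tuple_product:
  "(\<And>i. i \<in> {1..k} \<Longrightarrow> permutation (\<pi> i)) \<Longrightarrow> permutation (tuple_product k \<pi>)"
proof (induction k)
  case 0
  then show ?case by (simp add: tuple_product_def)
next
  case (Suc k)
  show ?case
    unfolding tuple_product_Suc by (intro permutation_compose Suc) auto
qed

lemma prod_list_sum_gel:
  fixes w :: "nat \<Rightarrow> (nat \<Rightarrow> nat) \<Rightarrow> 'a::comm_ring_1"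
  assumes P: "finite P" "\<And>f. f \<in> P \<Longrightarrow> permutation f"
  shows "prod_list (map (\<lambda>i. \<Sum>f\<in>P. scalar (w i f) * gel f) [1..<Suc k]) =
    (\<Sum>\<pi>\<in>{1..k} \<rightarrow>\<^sub>E P. scalar (\<Prod>i = 1..k. w i (\<pi> i)) * gel (tuple_product k \<pi>))"
proof (induction k)
  case 0
  then show ?case by (simp add: tuple_product_def gel_id[unfolded id_def])
next
  case (Suc k)
  let ?I = "{1..k}" and ?j = "Suc k"
  have I: "{1..?j} = insert ?j ?I" "?j \<notin> ?I" by auto
  have "(\<Sum>\<pi>\<in>{1..?j} \<rightarrow>\<^sub>E P. scalar (\<Prod>i = 1..?j. w i (\<pi> i)) * gel (tuple_product ?j \<pi>)) =
      (\<Sum>(f, \<pi>)\<in>P \<times> (?I \<rightarrow>\<^sub>E P). scalar (\<Prod>i = 1..?j. w i ((\<pi>(?j := f)) i)) * gel (tuple_product ?j (\<pi>(?j := f))))"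
    unfolding I(1) PiE_insert_eq
    by (subst sum.reindex[OF inj_combinator[OF I(2)]]) (simp add: case_prod_unfold comp_def)
  also have "\<dots> = (\<Sum>(f, \<pi>)\<in>P \<times> (?I \<rightarrow>\<^sub>E P).
      (scalar (\<Prod>i = 1..k. w i (\<pi> i)) * gel (tuple_product k \<pi>)) * (scalar (w ?j f) * gel f))"
  proof (intro sum.cong refl, clarify)
    fix f \<pi> assume f: "f \<in> P" and \<pi>: "\<pi> \<in> ?I \<rightarrow>\<^sub>E P"
    have perm: "permutation (tuple_product k \<pi>)"
      using \<pi> P(2) by (intro permutation_tuple_product) (metis PiE_mem)
    have tp: "tuple_product ?j (\<pi>(?j := f)) = tuple_product k \<pi> \<circ> f"
      using tuple_product_cong[of k "\<pi>(?j := f)" \<pi>] by (simp add: tuple_product_Suc)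
    have w: "(\<Prod>i = 1..?j. w i ((\<pi>(?j := f)) i)) = (\<Prod>i = 1..k. w i (\<pi> i)) * w ?j f"
      by simp
    show "scalar (\<Prod>i = 1..?j. w i ((\<pi>(?j := f)) i)) * gel (tuple_product ?j (\<pi>(?j := f))) =
      (scalar (\<Prod>i = 1..k. w i (\<pi> i)) * gel (tuple_product k \<pi>)) * (scalar (w ?j f) * gel f)"
      unfolding tp w using perm P(2)[OF f]
      by (simp add: scalar_mult scalar_left_commute gel_mult mult.assoc)
  qed
  also have "\<dots> = (\<Sum>\<pi>\<in>?I \<rightarrow>\<^sub>E P. scalar (\<Prod>i = 1..k. w i (\<pi> i)) * gel (tuple_product k \<pi>)) *
      (\<Sum>f\<in>P. scalar (w ?j f) * gel f)"
    by (simp add: sum_product sum.cartesian_product[symmetric] sum.swap[of _ P])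
  also have "\<dots> = prod_list (map (\<lambda>i. \<Sum>f\<in>P. scalar (w i f) * gel f) [1..<Suc ?j])"
    unfolding Suc.IH[symmetric] by simp
  finally show ?case by simp
qed

lemma tr_prod_list_sum_gel:
  fixes w :: "nat \<Rightarrow> (nat \<Rightarrow> nat) \<Rightarrow> 'a::comm_ring_1"
  assumes P: "finite P" "\<And>f. f \<in> P \<Longrightarrow> permutation f" and \<sigma>: "permutation \<sigma>"
  shows "tr (prod_list (map (\<lambda>i. \<Sum>f\<in>P. scalar (w i f) * gel f) [1..<Suc k]) * gel (inv' \<sigma>)) =
    (\<Sum>\<pi> | \<pi> \<in> {1..k} \<rightarrow>\<^sub>E P \<and> tuple_product k \<pi> = \<sigma>. \<Prod>i = 1..k. w i (\<pi> i))"
proof -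
  let ?S = "{1..k} \<rightarrow>\<^sub>E P"
  have fin: "finite ?S"
    using P by (intro finite_PiE) auto
  have "tr (gel (tuple_product k \<pi>) * gel (inv' \<sigma>)) = (if tuple_product k \<pi> = \<sigma> then 1 else 0 :: 'a)"
    if "\<pi> \<in> ?S" for \<pi>
  proof -
    have perm: "permutation (tuple_product k \<pi>)"
      using that P(2) by (intro permutation_tuple_product) (metis PiE_mem)
    have "tuple_product k \<pi> \<circ> inv' \<sigma> = id \<longleftrightarrow> tuple_product k \<pi> = \<sigma>"
      using permutation_inverse_works[OF \<sigma>] by (metis comp_assoc comp_id id_comp)
    then show ?thesis
      using perm \<sigma> by (simp add: gel_mult tr_gel permutation_compose permutation_inverse)
  qed
  then have "tr (prod_list (map (\<lambda>i. \<Sum>f\<in>P. scalar (w i f) * gel f) [1..<Suc k]) * gel (inv' \<sigma>)) =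
      (\<Sum>\<pi>\<in>?S. if tuple_product k \<pi> = \<sigma> then \<Prod>i = 1..k. w i (\<pi> i) else 0)"
    by (simp only: prod_list_sum_gel[where P = P and w = w, OF P] sum_distrib_right tr_sum mult.assoc tr_scalar)
      (intro sum.cong refl, auto)
  also have "\<dots> = (\<Sum>\<pi> | \<pi> \<in> ?S \<and> tuple_product k \<pi> = \<sigma>. \<Prod>i = 1..k. w i (\<pi> i))"
    by (rule sum.inter_filter[OF fin, symmetric])
  finally show ?thesis .
qed

text \<open>The product of the tuple lies in the generated group and permutes the points other than
  \<open>c\<close> in one cycle, so \<open>c\<close> is joined to them as soon as one factor moves
  it. If all factors fix \<open>c\<close>, so does the whole group.\<close>

lemma generates_transitive_iff:
  assumes k: "\<pi> \<in> {1..k} \<rightarrow> {f. f permutes {1..n}}"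
    and cs: "distinct cs" "{1..n} = insert c (set cs)" "c \<notin> set cs" "cs \<noteq> []"
    and tp: "tuple_product k \<pi> = cycle_of_list cs"
  shows "generates_transitive n (\<pi> ` {1..k}) \<longleftrightarrow> \<not> (\<forall>i\<in>{1..k}. \<pi> i permutes set cs)"
proof -
  let ?G = "sym_group n" and ?H = "generate (sym_group n) (\<pi> ` {1..k})" and ?s = "cycle_of_list cs"
  interpret group ?G by (rule sym_group_is_group)
  have sub: "\<pi> ` {1..k} \<subseteq> carrier ?G"
    using k by (auto simp: sym_group_def)
  interpret H: subgroup ?H ?G
    using sub by (rule generate_is_subgroup)
  have comp: "f \<circ> g \<in> ?H" if "f \<in> ?H" "g \<in> ?H" for f g
    using H.m_closed[OF that] by (simp add: sym_group_def)
  have idH: "id \<in> ?H"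
    using H.one_closed by (simp add: sym_group_def)
  have inv_comp: "(inv\<^bsub>?G\<^esub> g) (g y) = y" if "g \<in> carrier ?G" for g y
    using l_inv[OF that] by (simp add: sym_group_def fun_eq_iff)
  show ?thesis
  proof
    assume trans: "generates_transitive n (\<pi> ` {1..k})"
    show "\<not> (\<forall>i\<in>{1..k}. \<pi> i permutes set cs)"
    proof
      assume all: "\<forall>i\<in>{1..k}. \<pi> i permutes set cs"
      have fix_c: "g c = c" if "g \<in> ?H" for g
        using that
      proof induction
        case one
        then show ?case by (simp add: sym_group_def)
      next
        case (incl h)
        then show ?case using all cs(3) permutes_not_in by fastforce
      next
        case (inv h)
        then have "h c = c" using all cs(3) permutes_not_in by fastforce
        then show ?case using inv_comp[of h c] inv sub by auto
      next
        case (eng f g)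
        then show ?case by (simp add: sym_group_def)
      qed
      \<comment> \<open>A point other than \<open>c\<close> exists because the cycle list is
        nonempty, even if it has length 1.\<close>
      obtain a where "a \<in> set cs" using cs(4) by (cases cs) auto
      then have "a \<in> {1..n}" "c \<in> {1..n}" "a \<noteq> c" using cs(2,3) by auto
      then show False
        using trans fix_c unfolding generates_transitive_def by metis
    qed
  next
    assume "\<not> (\<forall>i\<in>{1..k}. \<pi> i permutes set cs)"
    then obtain i where i: "i \<in> {1..k}" "\<not> \<pi> i permutes set cs" by blast
    have pi: "\<pi> i permutes insert c (set cs)"
      using k i cs(2) by auto
    have "\<pi> i c \<noteq> c"
    proof
      assume "\<pi> i c = c"
      then have "\<pi> i permutes set cs"
        using permutes_superset[OF pi, of "set cs"] by auto
      then show False using i by simp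
    qed
    obtain e where e: "\<pi> i e = c"
      using permutes_surj[OF pi] by (metis surjD)
    then have "e \<noteq> c" using \<open>\<pi> i c \<noteq> c\<close> by auto
    moreover have "e \<in> insert c (set cs)"
      using permutes_in_image[OF pi, of e] e by simp
    ultimately have e_cs: "e \<in> set cs" by simp
    have "tuple_product j \<pi> \<in> ?H" if "j \<le> k" for j
      using that
    proof (induction j)
      case 0
      then show ?case using idH by (simp add: tuple_product_def id_def)
    next
      case (Suc j)
      show ?case
        unfolding tuple_product_Suc
      proof (rule comp)
        show "tuple_product j \<pi> \<in> ?H"
          using Suc by simp
        show "\<pi> (Suc j) \<in> ?H"
          using Suc.prems by (intro generate.incl) auto
      qed
    qed
    then have sH: "?s \<in> ?H" using tp by (metis order_refl)
    have spow: "?s ^^ j \<in> ?H" for j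
    proof (induction j)
      case (Suc j)
      then show ?case using comp[OF sH Suc] by (simp only: funpow.simps)
    qed (simp only: funpow.simps idH)
    have perm: "permutation ?s"
      by (rule permutation_of_cycle)
    \<comment> \<open>A power of the cycle brings \<open>a\<close> to \<open>e\<close>, and
      \<open>\<pi> i\<close> sends \<open>e\<close> to \<open>c\<close>. Two such elements, one of
      them inverted, connect any two points.\<close>
    have to_c: "\<exists>g\<in>?H. g a = c" if "a \<in> {1..n}" for a
    proof (cases "a = c")
      case True
      then show ?thesis using idH by (intro bexI[of _ id]) auto
    next
      case False
      then have a: "a \<in> set cs" using that cs(2) by blast
      have nth: "\<exists>j. (?s ^^ j) (hd cs) = y" if y: "y \<in> set cs" for y
      proof -
        obtain j where j: "j < length cs" "cs ! j = y"
          using y by (metis in_set_conv_nth)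
        have "map (?s ^^ j) cs = rotate j cs"
          using cs(1) by (rule cyclic_rotation)
        then have "(?s ^^ j) (hd cs) = hd (rotate j cs)"
          using cs(4) by (metis list.map_sel(1))
        then show ?thesis
          using j cs(4) by (auto simp: hd_rotate_conv_nth)
      qed
      obtain j l where "(?s ^^ j) (hd cs) = a" "(?s ^^ l) (hd cs) = e"
        using nth[OF a] nth[OF e_cs] by blast
      then have "e \<in> Orbits.orbit ?s (hd cs)" "a \<in> Orbits.orbit ?s (hd cs)"
        unfolding orbit_altdef_permutation[OF perm] by blast+
      then have "e \<in> Orbits.orbit ?s a"
        using orbit_cyclic_eq3[OF cyclic_on_orbit'[OF perm, of "hd cs"], of a] by blast
      then obtain l where l: "(?s ^^ l) a = e"
        unfolding orbit_altdef_permutation[OF perm] by blast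
      have "\<pi> i \<circ> ?s ^^ l \<in> ?H"
        using i by (intro comp spow generate.incl) auto
      then show ?thesis
        using l e by (intro bexI[of _ "\<pi> i \<circ> ?s ^^ l"]) simp_all
    qed
    show "generates_transitive n (\<pi> ` {1..k})"
      unfolding generates_transitive_def
    proof (intro ballI)
      fix a b assume "a \<in> {1..n}" "b \<in> {1..n}"
      then obtain f g where f: "f \<in> ?H" "f a = c" and g: "g \<in> ?H" "g b = c"
        using to_c by blast
      have "inv\<^bsub>?G\<^esub> g \<circ> f \<in> ?H"
        using f g by (intro comp H.m_inv_closed)
      moreover have "(inv\<^bsub>?G\<^esub> g \<circ> f) a = b"
        using inv_comp[OF H.mem_carrier[OF g(1)], of b] f g by simp
      ultimately show "\<exists>g\<in>?H. g a = b" by blast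
    qed
  qed
qed

text \<open>Groups the tuples by their vectors of cycle counts. These counts lie between 1 and
  \<open>n\<close>, which cuts the sum over all positive tuples down to a finite box.\<close>

lemma sum_b_count:
  fixes x :: "nat \<Rightarrow> 'a::field_char_0"
  assumes "n > 0"
  shows "sum' (\<lambda>r. of_nat (b_count n k \<sigma> r) * (\<Prod>i = 1..k. x i ^ r i)) (pos_tuples k) =
    (\<Sum>\<pi> | \<pi> \<in> {1..k} \<rightarrow>\<^sub>E {f. f permutes {1..n}} \<and> tuple_product k \<pi> = \<sigma> \<and>
        generates_transitive n (\<pi> ` {1..k}). \<Prod>i = 1..k. x i ^ cyc {1..n} (\<pi> i))"
    (is "_ = sum ?h ?S")
proof -
  let ?R = "{1..k} \<rightarrow>\<^sub>E {1..n}"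
  have finS: "finite ?S"
    by (rule finite_subset[of _ "{1..k} \<rightarrow>\<^sub>E {f. f permutes {1..n}}"])
      (auto intro!: finite_PiE simp: finite_permutations)
  \<comment> \<open>The restriction makes \<open>g \<pi>\<close> an extensional tuple, so that it
    can be equal to an index \<open>r\<close>.\<close>
  define g where "g = (\<lambda>\<pi>. \<lambda>i\<in>{1..k}. num_cycles n (\<pi> i))"
  have cyc_pos: "num_cycles n f \<in> {1..n}" for f
  proof -
    have "num_cycles n f \<le> n"
      unfolding num_cycles_def using card_image_le[of "{1..n}" "Orbits.orbit f"] by simp
    moreover have "num_cycles n f \<noteq> 0"
      using assms by (simp add: num_cycles_def card_eq_0_iff)
    ultimately show ?thesis by simp
  qed
  have "sum' (\<lambda>r. of_nat (b_count n k \<sigma> r) * (\<Prod>i = 1..k. x i ^ r i)) (pos_tuples k) =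
      sum' (\<lambda>r. of_nat (b_count n k \<sigma> r) * (\<Prod>i = 1..k. x i ^ r i)) ?R"
  proof (rule sum.mono_neutral_right')
    show "?R \<subseteq> pos_tuples k"
      unfolding pos_tuples_def by (intro PiE_mono) auto
    show "\<forall>r\<in>pos_tuples k - ?R. of_nat (b_count n k \<sigma> r) * (\<Prod>i = 1..k. x i ^ r i) = 0"
    proof
      fix r assume "r \<in> pos_tuples k - ?R"
      then obtain i where "i \<in> {1..k}" "r i > n"
        by (auto simp: pos_tuples_def PiE_iff not_le)
      then show "of_nat (b_count n k \<sigma> r) * (\<Prod>i = 1..k. x i ^ r i) = 0"
        using b_count_eq_0 by simp
    qed
  qed
  also have "\<dots> = (\<Sum>r\<in>?R. of_nat (b_count n k \<sigma> r) * (\<Prod>i = 1..k. x i ^ r i))"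
    by (rule sum.eq_sum) (auto intro!: finite_PiE)
  also have "\<dots> = (\<Sum>r\<in>?R. sum ?h {\<pi> \<in> ?S. g \<pi> = r})"
  proof (rule sum.cong)
    fix r assume r: "r \<in> ?R"
    have eq: "transitive_factorizations n k \<sigma> r = {\<pi> \<in> ?S. g \<pi> = r}"
    proof -
      have "g \<pi> = r \<longleftrightarrow> (\<forall>i\<in>{1..k}. num_cycles n (\<pi> i) = r i)" for \<pi>
        using r by (auto simp: g_def fun_eq_iff PiE_iff extensional_def restrict_def)
      then show ?thesis
        by (auto simp: transitive_factorizations_def sym_group_def)
    qed
    have "sum ?h {\<pi> \<in> ?S. g \<pi> = r} = (\<Sum>\<pi>\<in>{\<pi> \<in> ?S. g \<pi> = r}. \<Prod>i = 1..k. x i ^ r i)"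
      by (intro sum.cong prod.cong refl) (auto simp: g_def cyc_def num_cycles_def)
    then show "of_nat (b_count n k \<sigma> r) * (\<Prod>i = 1..k. x i ^ r i) = sum ?h {\<pi> \<in> ?S. g \<pi> = r}"
      unfolding b_count_def eq by simp
  qed simp
  also have "\<dots> = sum ?h ?S"
    using finS cyc_pos by (intro sum.group) (auto simp: g_def intro!: finite_PiE)
  finally show ?thesis .
qed

section \<open>The generating function\<close>

lemma content_prod_altdef: "content_prod x b l = (\<Prod>j<Suc (b + l). x - of_nat b + of_nat j)"
proof (induction l)
  case 0
  \<comment> \<open>Corner and leg in reversed order have increasing contents from \<open>-b\<close>
    to 0; each cell of the arm continues this run of consecutive integers.\<close>
  have "(\<Prod>i<Suc b. x - of_nat i) = (\<Prod>j<Suc b. x - of_nat (Suc b - Suc j))"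
    by (rule prod.nat_diff_reindex[symmetric])
  also have "\<dots> = (\<Prod>j<Suc b. x - of_nat b + of_nat j)"
    by (intro prod.cong) (auto simp: of_nat_diff)
  finally show ?case by (simp add: content_prod_def)
next
  case (Suc l)
  have "content_prod x b (Suc l) = content_prod x b l * (x + of_nat (Suc l))"
    by (simp add: content_prod_def mult.assoc)
  also have "x + of_nat (Suc l) = x - of_nat b + of_nat (Suc (b + l))"
    by simp
  finally show ?case
    unfolding Suc by simp
qed

text \<open>Interpolates between content products: for \<open>t\<close> from 1 to \<open>N\<close>
  it is \<open>x\<close> times that of the hook with \<open>N\<close> cells and leg length
  \<open>t - 1\<close>, while \<open>t = 0\<close> and \<open>t = Suc N\<close> give the single row
  and the single column with \<open>Suc N\<close> cells.\<close>

definition shifted_prod :: "nat \<Rightarrow> nat \<Rightarrow> 'a::comm_ring_1 \<Rightarrow> 'a" where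
  "shifted_prod N t x = x * (\<Prod>j<N. x - of_nat t + of_nat (Suc j))"

lemma shifted_prod_Suc: "shifted_prod (Suc (b + l)) (Suc b) x = x * content_prod x b l"
  unfolding shifted_prod_def content_prod_altdef by (simp add: algebra_simps)

lemma shifted_prod_0: "shifted_prod N 0 x = content_prod x 0 N"
  unfolding shifted_prod_def content_prod_def by simp

lemma shifted_prod_last: "shifted_prod N (Suc N) x = content_prod x N 0"
  unfolding shifted_prod_def content_prod_altdef by (simp add: mult.commute algebra_simps)

lemma alternating_sum_telescope:
  fixes f :: "nat \<Rightarrow> 'a::comm_ring_1"
  shows "(\<Sum>b\<le>M. (-1) ^ b * (f b + f (Suc b))) = f 0 + (-1) ^ M * f (Suc M)"
  by (induction M) (simp_all add: algebra_simps)

text \<open>The product is \<open>fact N\<close> times a generalized binomial coefficient with upper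
  entry \<open>(x - 1) + (Suc N - t)\<close>, which Vandermonde's convolution splits; the term of
  index \<open>q\<close> becomes the one for \<open>p = Suc q\<close>. The guard
  \<open>t \<le> p\<close> excludes the truncated difference \<open>p - t = 0\<close>, whose
  binomial coefficient would be 1.\<close>

lemma shifted_prod_expand:
  fixes x :: "'a::field_char_0"
  assumes "t \<le> Suc N"
  shows "shifted_prod N t x = fact N * (\<Sum>p = 1..Suc N.
    (if t \<le> p then of_nat ((Suc N - t) choose (p - t)) else 0) * (falling_factorial x p / fact (p - 1)))"
proof -
  have "(\<Prod>j<N. x - of_nat t + of_nat (Suc j)) = (\<Prod>j = 0..<N. (x - of_nat t + of_nat N) - of_nat j)"
  proof -
    have "(\<Prod>j<N. x - of_nat t + of_nat (Suc j)) = (\<Prod>j<N. x - of_nat t + of_nat (Suc (N - Suc j)))"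
      by (rule prod.nat_diff_reindex[symmetric])
    also have "\<dots> = (\<Prod>j<N. (x - of_nat t + of_nat N) - of_nat j)"
      by (intro prod.cong) (auto simp: Suc_diff_Suc of_nat_diff)
    finally show ?thesis by (simp add: lessThan_atLeast0)
  qed
  also have "\<dots> = fact N * ((x - of_nat t + of_nat N) gchoose N)"
    by (simp add: gbinomial_prod_rev)
  also have "x - of_nat t + of_nat N = (x - 1) + of_nat (Suc N - t)"
    using assms by (simp add: of_nat_diff)
  also have "((x - 1) + of_nat (Suc N - t)) gchoose N =
      (\<Sum>q = 0..N. ((x - 1) gchoose q) * (of_nat (Suc N - t) gchoose (N - q)))"
    by (rule gbinomial_Vandermonde[symmetric])
  also have "x * (fact N * \<dots>) = fact N * (\<Sum>q = 0..N.
      (if t \<le> Suc q then of_nat ((Suc N - t) choose (Suc q - t)) else 0) * (falling_factorial x (Suc q) / fact q))"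
    unfolding mult.left_commute[of x "fact N"] sum_distrib_left
  proof (intro sum.cong refl)
    fix q assume q: "q \<in> {0..N}"
    have 1: "x * ((x - 1) gchoose q) = falling_factorial x (Suc q) / fact q"
      unfolding gbinomial_prod_rev falling_factorial_def prod.lessThan_Suc_shift
      by (simp add: lessThan_atLeast0 algebra_simps)
    have 2: "(of_nat (Suc N - t) gchoose (N - q)) =
        (if t \<le> Suc q then of_nat ((Suc N - t) choose (Suc q - t)) else 0 :: 'a)"
    proof (cases "t \<le> Suc q")
      case True
      have "(Suc N - t) choose (N - q) = (Suc N - t) choose (Suc N - t - (N - q))"
        using q True assms by (intro binomial_symmetric) auto
      also have "Suc N - t - (N - q) = Suc q - t"
        using q True by auto
      finally show ?thesis
        using True by (simp flip: binomial_gbinomial)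
    next
      case False
      then have "Suc N - t < N - q" using q assms by auto
      then show ?thesis
        using False by (simp add: binomial_eq_0 flip: binomial_gbinomial)
    qed
    show "fact N * (x * (((x - 1) gchoose q) * (of_nat (Suc N - t) gchoose (N - q)))) =
      fact N * ((if t \<le> Suc q then of_nat ((Suc N - t) choose (Suc q - t)) else 0) * (falling_factorial x (Suc q) / fact q))"
      unfolding 2 1[symmetric] by (simp only: ac_simps)
  qed
  also have "\<dots> = fact N * (\<Sum>p = 1..Suc N.
    (if t \<le> p then of_nat ((Suc N - t) choose (p - t)) else 0) * (falling_factorial x p / fact (p - 1)))"
    unfolding One_nat_def sum.shift_bounds_cl_Suc_ivl by simp
  finally show ?thesis
    unfolding shifted_prod_def .
qed

text \<open>The guard takes over the role of the upper limit \<open>Min\<close>, so that the range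
  of \<open>t\<close> no longer depends on \<open>p\<close> and the two summations can be
  exchanged.\<close>

lemma M_coeff_altdef:
  assumes "k \<ge> 1" "p \<in> {1..k} \<rightarrow>\<^sub>E {1..n}"
  shows "(of_int (M_coeff n k p) :: 'a::field_char_0) =
    (\<Sum>t\<le>n. (-1) ^ t * of_nat (n choose t) *
      (\<Prod>i = 1..k. if t \<le> p i then of_nat ((n - t) choose (p i - t)) else 0))"
proof -
  have ne: "finite (p ` {1..k})" "p ` {1..k} \<noteq> {}"
    using assms(1) by auto
  have Min: "t \<le> Min (p ` {1..k}) \<longleftrightarrow> (\<forall>i\<in>{1..k}. t \<le> p i)" for t
    using ne by simp
  have "p 1 \<le> n" using assms by (auto dest: PiE_mem)
  moreover have "Min (p ` {1..k}) \<le> p 1"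
    using assms(1) by (intro Min_le) auto
  ultimately have sub: "{0..Min (p ` {1..k})} \<subseteq> {..n}" by auto
  have "(\<Sum>t\<le>n. (-1) ^ t * of_nat (n choose t) *
      (\<Prod>i = 1..k. if t \<le> p i then of_nat ((n - t) choose (p i - t)) else 0 :: 'a)) =
    (\<Sum>t = 0..Min (p ` {1..k}). (-1) ^ t * of_nat (n choose t) *
      (\<Prod>i = 1..k. if t \<le> p i then of_nat ((n - t) choose (p i - t)) else 0 :: 'a))"
  proof (rule sum.mono_neutral_right)
    show "\<forall>t\<in>{..n} - {0..Min (p ` {1..k})}. (-1) ^ t * of_nat (n choose t) *
      (\<Prod>i = 1..k. if t \<le> p i then of_nat ((n - t) choose (p i - t)) else 0 :: 'a) = 0"
    proof
      fix t assume "t \<in> {..n} - {0..Min (p ` {1..k})}"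
      then have "\<not> t \<le> Min (p ` {1..k})" by simp
      then obtain i where "i \<in> {1..k}" "\<not> t \<le> p i" using Min by blast
      then have "(\<Prod>i = 1..k. if t \<le> p i then of_nat ((n - t) choose (p i - t)) else 0 :: 'a) = 0"
        by (intro prod_zero) auto
      then show "(-1) ^ t * of_nat (n choose t) *
        (\<Prod>i = 1..k. if t \<le> p i then of_nat ((n - t) choose (p i - t)) else 0 :: 'a) = 0"
        by simp
    qed
  qed (use sub in auto)
  also have "\<dots> = of_int (M_coeff n k p)"
    unfolding M_coeff_def of_int_sum of_int_mult of_int_prod of_int_power of_int_minus of_int_1 of_int_of_nat_eq
    using Min by (intro sum.cong refl arg_cong2[where f = "(*)"] prod.cong) auto
  finally show ?thesis by simp
qed

lemma sum_M_coeff: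
  fixes x :: "nat \<Rightarrow> 'a::field_char_0"
  assumes "k \<ge> 1"
  shows "(\<Sum>t\<le>Suc N. (-1) ^ t * of_nat (Suc N choose t) * (\<Prod>i = 1..k. shifted_prod N t (x i))) =
    fact N ^ k * sum' (\<lambda>p. of_int (M_coeff (Suc N) k p) *
      (\<Prod>i = 1..k. falling_factorial (x i) (p i) / fact (p i - 1))) (pos_tuples k)"
proof -
  let ?R = "{1..k} \<rightarrow>\<^sub>E {1..Suc N}"
  let ?c = "\<lambda>t p. if t \<le> p then of_nat ((Suc N - t) choose (p - t)) else 0 :: 'a"
  let ?F = "\<lambda>p. \<Prod>i = 1..k. falling_factorial (x i) (p i) / fact (p i - 1)"
  have "sum' (\<lambda>p. of_int (M_coeff (Suc N) k p) * ?F p) (pos_tuples k) =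
      sum' (\<lambda>p. of_int (M_coeff (Suc N) k p) * ?F p) ?R"
  proof (rule sum.mono_neutral_right')
    show "?R \<subseteq> pos_tuples k"
      unfolding pos_tuples_def by (intro PiE_mono) auto
    show "\<forall>p\<in>pos_tuples k - ?R. of_int (M_coeff (Suc N) k p) * ?F p = 0"
    proof
      fix p assume "p \<in> pos_tuples k - ?R"
      then obtain i where "i \<in> {1..k}" "p i > Suc N"
        by (auto simp: pos_tuples_def PiE_iff not_le)
      then show "of_int (M_coeff (Suc N) k p) * ?F p = 0"
        using M_coeff_eq_0 by simp
    qed
  qed
  also have "\<dots> = (\<Sum>p\<in>?R. of_int (M_coeff (Suc N) k p) * ?F p)"
    by (rule sum.eq_sum) (auto intro!: finite_PiE)
  finally have "fact N ^ k * sum' (\<lambda>p. of_int (M_coeff (Suc N) k p) * ?F p) (pos_tuples k) =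
      fact N ^ k * (\<Sum>p\<in>?R. of_int (M_coeff (Suc N) k p) * ?F p)"
    by (rule arg_cong)
  also have "\<dots> = (\<Sum>p\<in>?R. \<Sum>t\<le>Suc N. (-1) ^ t * of_nat (Suc N choose t) *
      (fact N ^ k * ((\<Prod>i = 1..k. ?c t (p i)) * ?F p)))"
    unfolding sum_distrib_left
  proof (rule sum.cong)
    fix p assume "p \<in> ?R"
    then show "fact N ^ k * (of_int (M_coeff (Suc N) k p) * ?F p) =
      (\<Sum>t\<le>Suc N. (-1) ^ t * of_nat (Suc N choose t) * (fact N ^ k * ((\<Prod>i = 1..k. ?c t (p i)) * ?F p)))"
      unfolding M_coeff_altdef[OF assms \<open>p \<in> ?R\<close>] sum_distrib_left sum_distrib_right
      by (intro sum.cong refl) (simp only: ac_simps)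
  qed simp
  also have "\<dots> = (\<Sum>t\<le>Suc N. \<Sum>p\<in>?R. (-1) ^ t * of_nat (Suc N choose t) *
      (fact N ^ k * ((\<Prod>i = 1..k. ?c t (p i)) * ?F p)))"
    by (rule sum.swap)
  also have "\<dots> = (\<Sum>t\<le>Suc N. (-1) ^ t * of_nat (Suc N choose t) * (\<Prod>i = 1..k. shifted_prod N t (x i)))"
  proof (rule sum.cong)
    fix t assume "t \<in> {..Suc N}"
    then have "(\<Prod>i = 1..k. shifted_prod N t (x i)) =
        (\<Prod>i = 1..k. fact N * (\<Sum>p = 1..Suc N. ?c t p * (falling_factorial (x i) p / fact (p - 1))))"
      by (intro prod.cong refl shifted_prod_expand) simp
    also have "\<dots> = fact N ^ k * (\<Prod>i = 1..k. \<Sum>p = 1..Suc N. ?c t p * (falling_factorial (x i) p / fact (p - 1)))"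
      by (simp only: prod.distrib prod_constant card_atLeastAtMost diff_Suc_1)
    also have "(\<Prod>i = 1..k. \<Sum>p = 1..Suc N. ?c t p * (falling_factorial (x i) p / fact (p - 1))) =
        (\<Sum>p\<in>?R. \<Prod>i = 1..k. ?c t (p i) * (falling_factorial (x i) (p i) / fact (p i - 1)))"
      by (rule prod_sum_PiE) auto
    also have "\<dots> = (\<Sum>p\<in>?R. (\<Prod>i = 1..k. ?c t (p i)) * ?F p)"
      by (simp only: prod.distrib)
    finally show "(\<Sum>p\<in>?R. (-1) ^ t * of_nat (Suc N choose t) * (fact N ^ k * ((\<Prod>i = 1..k. ?c t (p i)) * ?F p))) =
        (-1) ^ t * of_nat (Suc N choose t) * (\<Prod>i = 1..k. shifted_prod N t (x i))"
      by (simp only: sum_distrib_left)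
  qed simp
  finally show ?thesis by (rule sym)
qed

text \<open>All tuples minus those whose entries fix \<open>c\<close>. The scalar \<open>x\<close>
  accounts for the fixed point \<open>c\<close>, which is a cycle on
  \<open>insert c A\<close>.\<close>

definition transitive_elem :: "'a::comm_ring_1 list \<Rightarrow> 'b set \<Rightarrow> 'b \<Rightarrow> ('b, 'a) galg" where
  "transitive_elem xs A c =
    prod_list (map (\<lambda>x. cyc_sum x (insert c A)) xs) - prod_list (map (\<lambda>x. scalar x * cyc_sum x A) xs)"

lemma commute_prod_list:
  assumes "\<And>z. z \<in> set zs \<Longrightarrow> g * z = z * (g :: 'r::monoid_mult)"
  shows "g * prod_list zs = prod_list zs * g"
  using assms by (induction zs) (simp_all, metis mult.assoc)

lemma gel_commute_transitive_elem:
  assumes "finite A" "g permutes A"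
  shows "gel g * transitive_elem xs A c = transitive_elem xs A c * gel g"
proof -
  have "g permutes insert c A"
    using assms(2) by (rule permutes_subset) auto
  then have "gel g * prod_list (map (\<lambda>x. cyc_sum x (insert c A)) xs) =
      prod_list (map (\<lambda>x. cyc_sum x (insert c A)) xs) * gel g"
    using assms by (intro commute_prod_list) (auto simp: gel_commute_cyc_sum)
  moreover have "gel g * prod_list (map (\<lambda>x. scalar x * cyc_sum x A) xs) =
      prod_list (map (\<lambda>x. scalar x * cyc_sum x A) xs) * gel g"
    using assms by (intro commute_prod_list)
      (auto simp: gel_commute_cyc_sum scalar_left_commute mult.assoc)
  ultimately show ?thesis
    by (simp add: transitive_elem_def algebra_simps)
qed

text \<open>The subtracted product acts on the hook by \<open>u 0\<close>, so it changes only the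
  weight of the eigenvalue 0, from \<open>1 - N / (a * b)\<close> to
  \<open>- N / (a * b)\<close>.\<close>

lemma tr_transitive_elem_hook:
  fixes xs :: "'a::field_char_0 list"
  assumes A: "hook_partition A F m B" and c: "c \<notin> A"
  defines "a \<equiv> of_nat (Suc (card B))" and "b \<equiv> of_nat (Suc (card F))"
    and "N \<equiv> of_nat (card A)" and "n \<equiv> of_nat (Suc (card A))"
  defines "u \<equiv> \<lambda>y. prod_list (map (\<lambda>x. (x + y) * content_prod x (card F) (card B)) xs)"
  shows "n * tr (transitive_elem xs A c * hook F m B) = N / a * u a + N / b * u (- b) - n * N / (a * b) * u 0"
proof -
  let ?h = "hook F m B :: ('b, 'a) galg"
  define T where "T = tr (prod_list (map (\<lambda>x. cyc_sum x (insert c A)) xs) * ?h)"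
  have "card A = Suc (card F + card B)"
    using A by (auto simp: hook_partition_def card_Un_disjoint)
  then have "a + b = n"
    unfolding a_def b_def n_def by simp
  moreover have "a \<noteq> 0" "b \<noteq> 0" "n \<noteq> 0"
    unfolding a_def b_def n_def of_nat_eq_0_iff by simp_all
  ultimately have ab: "a + b = n" "a \<noteq> 0" "b \<noteq> 0" "n \<noteq> 0" .
  have T: "a * b * (a + b) * T = N * (b * u a + a * u (- b)) + (a + b) * (a * b - N) * u 0"
    using tr_cyc_sum_prod_hook[OF A c, of xs] unfolding a_def b_def N_def u_def T_def .
  have "n * T = a * b * (a + b) * T / (a * b)"
    using ab by simp
  also have "\<dots> = N / a * u a + N / b * u (- b) + n * (1 - N / (a * b)) * u 0"
    unfolding T unfolding ab(1) using ab(2-) by (simp add: field_simps)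
  finally have "n * T = N / a * u a + N / b * u (- b) + n * (1 - N / (a * b)) * u 0" .
  moreover have "tr (prod_list (map (\<lambda>x. scalar x * cyc_sum x A) xs) * ?h) = u 0"
  proof -
    \<comment> \<open>This is the eigenvalue of \<open>cyc_sum x (insert c A)\<close> with the
      Jucys--Murphy element of \<open>c\<close> replaced by 0.\<close>
    have "scalar x * cyc_sum x A * ?h = scalar ((x + 0) * content_prod x (card F) (card B)) * ?h" for x
      by (simp add: cyc_sum_mult_hook[OF A] scalar_mult mult.assoc)
    then have "prod_list (map (\<lambda>x. scalar x * cyc_sum x A) xs) * ?h = scalar (u 0) * ?h"
      unfolding u_def by (rule prod_list_eigenvector)
    then show ?thesis
      using tr_hook[OF A, where 'a = 'a] by (simp add: tr_scalar)
  qed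
  ultimately show ?thesis
    unfolding transitive_elem_def left_diff_distrib tr_diff T_def by (simp add: algebra_simps)
qed

text \<open>Lengthening the arm of one hook and the leg of the preceding one gives the same hook
  with \<open>Suc N\<close> cells. These terms occur with opposite signs and telescope; the two end
  terms and the contributions of the inner corner form the sum over \<open>t\<close>.\<close>

lemma tr_transitive_elem_long_cycle:
  fixes xs :: "'a::field_char_0 list"
  assumes cs: "distinct cs" "length cs = N" "N \<ge> 1" and c: "c \<notin> set cs"
  shows "fact (Suc N) * tr (transitive_elem xs (set cs) c * gel (inv' (cycle_of_list cs))) =
    (\<Sum>t\<le>Suc N. (-1) ^ t * of_nat (Suc N choose t) * prod_list (map (shifted_prod N t) xs))"
proof -
  obtain M where M: "N = Suc M"
    using cs(3) by (cases N) auto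
  let ?r = "transitive_elem xs (set cs) c"
  define C where "C = (\<lambda>b. prod_list (map (\<lambda>x. content_prod x b (N - b)) xs))"
  define E where "E = (\<lambda>t. prod_list (map (shifted_prod N t) xs))"
  define f where "f = (\<lambda>b. of_nat (N choose b) * C b)"
  define t where "t = (\<lambda>b. (of_nat N / of_nat (Suc (M - b)) * C b + of_nat N / of_nat (Suc b) * C (Suc b) -
    of_nat (Suc N) * of_nat N / (of_nat (Suc (M - b)) * of_nat (Suc b)) * E (Suc b)) / of_nat (Suc N))"
  have card: "card (set cs) = N"
    using cs distinct_card by blast
  have main: "fact (Suc M) * tr (?r * gel (inv' (cycle_of_list cs))) = (\<Sum>b\<le>M. (-1) ^ b * of_nat (M choose b) * t b)"
  proof (rule tr_long_cycle)
    fix F m B assume A: "hook_partition (set cs) F m B"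
    then have "card (set cs) = Suc (card F + card B)"
      by (auto simp: hook_partition_def card_Un_disjoint)
    then have cFB: "card B = M - card F" "card F \<le> M"
      using card M by auto
    \<comment> \<open>The factor \<open>x\<close> plus the eigenvalue adds the corresponding cell:
      at the end of the arm in \<open>1\<close>, at the end of the leg in \<open>2\<close>. In
      \<open>3\<close> the eigenvalue 0 leaves the factor \<open>x\<close> of
      \<open>shifted_prod\<close>.\<close>
    have 1: "(x + of_nat (Suc (card B))) * content_prod x (card F) (card B) = content_prod x (card F) (N - card F)"
      for x :: 'a
      using cFB M by (simp add: Suc_diff_le content_prod_def ac_simps)
    have 2: "(x + - of_nat (Suc (card F))) * content_prod x (card F) (card B) = content_prod x (Suc (card F)) (N - Suc (card F))"
      for x :: 'a
      using cFB M by (simp add: content_prod_def ac_simps)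
    have 3: "(x + 0) * content_prod x (card F) (card B) = shifted_prod N (Suc (card F)) x" for x :: 'a
      using shifted_prod_Suc[of "card F" "card B" x] cFB M by simp
    show "tr (?r * hook F m B) = t (card F)"
      using tr_transitive_elem_hook[OF A c, of xs] unfolding card 1 2 3 C_def[symmetric] E_def[symmetric]
      by (simp add: t_def C_def E_def cFB(1) eq_divide_eq mult.commute del: of_nat_Suc)
  qed (use cs M in \<open>auto intro!: gel_commute_transitive_elem\<close>)
  have "fact (Suc N) * tr (?r * gel (inv' (cycle_of_list cs))) =
      (\<Sum>b\<le>M. of_nat (Suc N) * ((-1) ^ b * of_nat (M choose b) * t b))"
    unfolding sum_distrib_left[symmetric] main[symmetric] M by (simp only: fact_Suc of_nat_mult ac_simps)
  \<comment> \<open>The absorption identities for binomial coefficients turn the denominators of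
    \<open>t\<close> into \<open>N choose b\<close>, \<open>N choose Suc b\<close> and
    \<open>Suc N choose Suc b\<close>.\<close>
  also have "\<dots> = (\<Sum>b\<le>M. (-1) ^ b * (f b + f (Suc b)) - (-1) ^ b * (of_nat (Suc N choose Suc b) * E (Suc b)))"
  proof (rule sum.cong)
    fix b assume b: "b \<in> {..M}"
    have "Suc (M - b) * (N choose b) = N * (M choose b)"
      using b binomial_absorb_comp[of N b] M by (simp add: Suc_diff_le)
    then have "of_nat (Suc (M - b)) * of_nat (N choose b) = (of_nat N * of_nat (M choose b) :: 'a)"
      by (metis of_nat_mult)
    then have 1: "of_nat (M choose b) * (of_nat N / of_nat (Suc (M - b))) = (of_nat (N choose b) :: 'a)"
      by (simp add: field_simps del: of_nat_Suc)
    have "Suc b * (N choose Suc b) = N * (M choose b)"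
      unfolding M by (rule Suc_times_binomial)
    then have "of_nat (Suc b) * of_nat (N choose Suc b) = (of_nat N * of_nat (M choose b) :: 'a)"
      by (metis of_nat_mult)
    then have 2: "of_nat (M choose b) * (of_nat N / of_nat (Suc b)) = (of_nat (N choose Suc b) :: 'a)"
      by (simp add: field_simps del: of_nat_Suc)
    have "Suc b * (Suc N choose Suc b) = Suc N * (N choose b)"
      by (rule Suc_times_binomial)
    then have "of_nat (Suc b) * of_nat (Suc N choose Suc b) = (of_nat (Suc N) * of_nat (N choose b) :: 'a)"
      by (metis of_nat_mult)
    then have 3: "of_nat (N choose b) * (of_nat (Suc N) / of_nat (Suc b)) = (of_nat (Suc N choose Suc b) :: 'a)"
      by (simp add: field_simps del: of_nat_Suc binomial_Suc_Suc)
    have "of_nat (Suc N) * ((-1) ^ b * of_nat (M choose b) * t b) =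
        (-1) ^ b * (of_nat (M choose b) * (of_nat (Suc N) * t b))"
      by (simp only: ac_simps)
    also have "of_nat (Suc N) * t b = of_nat N / of_nat (Suc (M - b)) * C b + of_nat N / of_nat (Suc b) * C (Suc b) -
        (of_nat N / of_nat (Suc (M - b))) * (of_nat (Suc N) / of_nat (Suc b)) * E (Suc b)"
      unfolding t_def by (simp add: mult.commute del: of_nat_Suc)
    also have "of_nat (M choose b) * \<dots> = f b + f (Suc b) - of_nat (Suc N choose Suc b) * E (Suc b)"
      unfolding f_def 3[symmetric] 2[symmetric] 1[symmetric] by (simp only: algebra_simps)
    finally show "of_nat (Suc N) * ((-1) ^ b * of_nat (M choose b) * t b) =
        (-1) ^ b * (f b + f (Suc b)) - (-1) ^ b * (of_nat (Suc N choose Suc b) * E (Suc b))"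
      by (simp only: right_diff_distrib)
  qed simp
  also have "\<dots> = f 0 + (-1) ^ M * f (Suc M) - (\<Sum>b\<le>M. (-1) ^ b * (of_nat (Suc N choose Suc b) * E (Suc b)))"
    unfolding sum_subtractf alternating_sum_telescope by (rule refl)
  also have "f 0 = E 0"
    by (simp add: f_def C_def E_def shifted_prod_0[abs_def])
  also have "f (Suc M) = E (Suc N)"
    by (simp add: f_def C_def E_def shifted_prod_last[abs_def] M)
  \<comment> \<open>With \<open>t = Suc b\<close> the minus sign becomes part of the alternating
    sign; the last sign \<open>(-1) ^ M\<close> equals \<open>(-1) ^ Suc N\<close> because
    \<open>N = Suc M\<close>.\<close>
  also have "E 0 + (-1) ^ M * E (Suc N) - (\<Sum>b\<le>M. (-1) ^ b * (of_nat (Suc N choose Suc b) * E (Suc b))) =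
      (\<Sum>t\<le>Suc N. (-1) ^ t * of_nat (Suc N choose t) * E t)"
  proof -
    have "(\<Sum>t\<le>Suc N. (-1) ^ t * of_nat (Suc N choose t) * E t) =
        E 0 + (\<Sum>b\<le>Suc M. (-1) ^ Suc b * of_nat (Suc N choose Suc b) * E (Suc b))"
      unfolding M by (subst sum.atMost_Suc_shift) simp
    also have "\<dots> = E 0 + ((\<Sum>b\<le>M. (-1) ^ Suc b * of_nat (Suc N choose Suc b) * E (Suc b)) + (-1) ^ M * E (Suc N))"
      by (simp add: M binomial_eq_0)
    finally show ?thesis
      by (simp add: sum_negf mult.assoc del: binomial_Suc_Suc)
  qed
  finally show ?thesis
    unfolding E_def .
qed

theorem theorem2p9:
  fixes n k :: nat and \<sigma> :: "nat \<Rightarrow> nat" and x :: "nat \<Rightarrow> 'a::field_char_0"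
  assumes "n \<ge> 2" and "k \<ge> 1"
    and "is_cycle_of_length n (n - 1) \<sigma>"
  shows "sum' (\<lambda>r. of_nat (b_count n k \<sigma> r) * (\<Prod>i = 1..k. x i ^ r i)) (pos_tuples k) =
    (fact n ^ (k - 1) / of_nat n ^ k) *
    sum' (\<lambda>p. of_int (M_coeff n k p) *
                (\<Prod>i = 1..k. falling_factorial (x i) (p i) / fact (p i - 1))) (pos_tuples k)"
proof -
  obtain N where n: "n = Suc N" and N: "N \<ge> 1"
    using assms(1) by (cases n) auto
  obtain cs where cs: "distinct cs" "length cs = N" "set cs \<subseteq> {1..n}" and \<sigma>: "\<sigma> = cycle_of_list cs"
    using assms(3) unfolding is_cycle_of_length_def n by auto
  have "card (set cs) = N"
    using cs distinct_card by blast
  then have "card ({1..n} - set cs) = 1"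
    using cs(3) by (subst card_Diff_subset) (auto simp: n)
  \<comment> \<open>The point outside the cycle. For \<open>n = 2\<close> the permutation is the
    identity and fixes both points; \<open>c\<close> then depends on the list
    \<open>cs\<close>.\<close>
  then obtain c where c: "{1..n} - set cs = {c}"
    by (rule card_1_singletonE)
  let ?A = "set cs"
  have cA: "c \<notin> ?A" and ins: "{1..n} = insert c ?A"
    using c cs(3) by blast+
  let ?P = "{f. f permutes {1..n}}" and ?Q = "{f. f permutes ?A}"
  let ?xs = "map x [1..<Suc k]"
  let ?w = "\<lambda>i f. x i ^ cyc {1..n} f"
  have perm\<sigma>: "permutation \<sigma>"
    unfolding \<sigma> by (rule permutation_of_cycle)
  have QP: "f \<in> ?P" if "f \<in> ?Q" for f
    using that cs(3) permutes_subset by blast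
  let ?SP = "{\<pi>. \<pi> \<in> {1..k} \<rightarrow>\<^sub>E ?P \<and> tuple_product k \<pi> = \<sigma>}"
  let ?SQ = "{\<pi>. \<pi> \<in> {1..k} \<rightarrow>\<^sub>E ?Q \<and> tuple_product k \<pi> = \<sigma>}"
  let ?h = "\<lambda>\<pi>. \<Prod>i = 1..k. x i ^ cyc {1..n} (\<pi> i)"
  have finSP: "finite ?SP"
    by (rule finite_subset[of _ "{1..k} \<rightarrow>\<^sub>E ?P"]) (auto intro!: finite_PiE simp: finite_permutations)
  have SQP: "?SQ \<subseteq> ?SP"
    using QP by (auto simp: PiE_iff)
  have "sum' (\<lambda>r. of_nat (b_count n k \<sigma> r) * (\<Prod>i = 1..k. x i ^ r i)) (pos_tuples k) =
      sum ?h {\<pi>. \<pi> \<in> {1..k} \<rightarrow>\<^sub>E ?P \<and> tuple_product k \<pi> = \<sigma> \<and> generates_transitive n (\<pi> ` {1..k})}"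
    by (rule sum_b_count) (simp add: n)
  also have "{\<pi>. \<pi> \<in> {1..k} \<rightarrow>\<^sub>E ?P \<and> tuple_product k \<pi> = \<sigma> \<and> generates_transitive n (\<pi> ` {1..k})} = ?SP - ?SQ"
  proof -
    have "generates_transitive n (\<pi> ` {1..k}) \<longleftrightarrow> \<pi> \<notin> ?SQ" if "\<pi> \<in> ?SP" for \<pi>
    proof -
      have \<pi>: "\<pi> \<in> {1..k} \<rightarrow>\<^sub>E ?P" "tuple_product k \<pi> = \<sigma>" using that by auto
      have "generates_transitive n (\<pi> ` {1..k}) \<longleftrightarrow> \<not> (\<forall>i\<in>{1..k}. \<pi> i permutes ?A)"
        by (rule generates_transitive_iff) (use \<pi> cs N cA ins \<sigma> in \<open>auto simp: PiE_iff\<close>)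
      also have "\<dots> \<longleftrightarrow> \<pi> \<notin> ?SQ"
        using \<pi> by (auto simp: PiE_iff)
      finally show ?thesis .
    qed
    then show ?thesis by blast
  qed
  also have "sum ?h (?SP - ?SQ) = sum ?h ?SP - sum ?h ?SQ"
    using finSP SQP by (rule sum_diff)
  also have "sum ?h ?SP = tr (prod_list (map (\<lambda>i. \<Sum>f\<in>?P. scalar (?w i f) * gel f) [1..<Suc k]) * gel (inv' \<sigma>))"
    by (rule tr_prod_list_sum_gel[symmetric])
      (use perm\<sigma> finite_permutations permutation_permutes in auto)
  also have "sum ?h ?SQ = tr (prod_list (map (\<lambda>i. \<Sum>f\<in>?Q. scalar (?w i f) * gel f) [1..<Suc k]) * gel (inv' \<sigma>))"
    by (rule tr_prod_list_sum_gel[symmetric])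
      (use perm\<sigma> finite_permutations permutation_permutes in auto)
  also have "(\<lambda>i. \<Sum>f\<in>?P. scalar (?w i f) * gel f) = (\<lambda>i. cyc_sum (x i) (insert c ?A))"
    unfolding cyc_sum_def ins by (rule refl)
  \<comment> \<open>On \<open>{1..n}\<close> a permutation of \<open>?A\<close> has the additional
    cycle consisting of \<open>c\<close>, which yields the scalar \<open>x i\<close>.\<close>
  also have "(\<lambda>i. \<Sum>f\<in>?Q. scalar (?w i f) * gel f) = (\<lambda>i. scalar (x i) * cyc_sum (x i) ?A)"
    unfolding cyc_sum_def ins sum_distrib_left using cA
    by (intro ext sum.cong refl) (simp add: cyc_insert_fixed scalar_mult mult.assoc)
  also have "tr (prod_list (map (\<lambda>i. cyc_sum (x i) (insert c ?A)) [1..<Suc k]) * gel (inv' \<sigma>)) -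
      tr (prod_list (map (\<lambda>i. scalar (x i) * cyc_sum (x i) ?A) [1..<Suc k]) * gel (inv' \<sigma>)) =
      tr (transitive_elem ?xs ?A c * gel (inv' \<sigma>))"
    by (simp only: transitive_elem_def left_diff_distrib tr_diff map_map comp_def)
  finally have "fact n * sum' (\<lambda>r. of_nat (b_count n k \<sigma> r) * (\<Prod>i = 1..k. x i ^ r i)) (pos_tuples k) =
      fact (Suc N) * tr (transitive_elem ?xs ?A c * gel (inv' \<sigma>))"
    by (simp only: n)
  also have "\<dots> = (\<Sum>t\<le>Suc N. (-1) ^ t * of_nat (Suc N choose t) * prod_list (map (shifted_prod N t) ?xs))"
    unfolding \<sigma> by (rule tr_transitive_elem_long_cycle[OF cs(1,2) N cA])
  also have "\<dots> = (\<Sum>t\<le>Suc N. (-1) ^ t * of_nat (Suc N choose t) * (\<Prod>i = 1..k. shifted_prod N t (x i)))"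
  proof -
    have "prod_list (map (shifted_prod N t) ?xs) = (\<Prod>i = 1..k. shifted_prod N t (x i))" for t
      using prod.distinct_set_conv_list[of "[1..<Suc k]" "\<lambda>i. shifted_prod N t (x i)"]
      by (simp only: map_map comp_def distinct_upt set_upt atLeastLessThanSuc_atLeastAtMost simp_thms)
    then show ?thesis by simp
  qed
  also have "\<dots> = fact N ^ k * sum' (\<lambda>p. of_int (M_coeff (Suc N) k p) *
      (\<Prod>i = 1..k. falling_factorial (x i) (p i) / fact (p i - 1))) (pos_tuples k)"
    by (rule sum_M_coeff[OF assms(2)])
  finally have "fact n * sum' (\<lambda>r. of_nat (b_count n k \<sigma> r) * (\<Prod>i = 1..k. x i ^ r i)) (pos_tuples k) =
      fact N ^ k * sum' (\<lambda>p. of_int (M_coeff n k p) *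
        (\<Prod>i = 1..k. falling_factorial (x i) (p i) / fact (p i - 1))) (pos_tuples k)"
    by (simp only: n)
  then have "sum' (\<lambda>r. of_nat (b_count n k \<sigma> r) * (\<Prod>i = 1..k. x i ^ r i)) (pos_tuples k) =
      fact N ^ k / fact n * sum' (\<lambda>p. of_int (M_coeff n k p) *
        (\<Prod>i = 1..k. falling_factorial (x i) (p i) / fact (p i - 1))) (pos_tuples k)"
    by (simp add: eq_divide_eq mult.commute)
  \<comment> \<open>Since \<open>fact n\<close> is \<open>n\<close> times \<open>fact N\<close>, the
    power of \<open>fact N\<close> is that of \<open>fact n\<close> divided by \<open>n ^ k\<close>;
    the division by \<open>fact n\<close> lowers the exponent to \<open>k - 1\<close>.\<close>
  moreover have "fact N ^ k / fact n = (fact n ^ (k - 1) / of_nat n ^ k :: 'a)"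
  proof -
    obtain j where j: "k = Suc j" using assms(2) by (cases k) auto
    have "fact n = (of_nat n * fact N :: 'a)" by (simp only: n fact_Suc of_nat_mult)
    moreover have "(of_nat n :: 'a) \<noteq> 0" using n by (simp del: of_nat_Suc)
    ultimately show ?thesis
      unfolding j by (simp add: field_simps power_mult_distrib)
  qed
  ultimately show ?thesis by (simp only:)
qed

end
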